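(* For every integer $m\ge 1$, $H_m^1=Y$ (equality of sets of functions). However, $H_0^1\neq Y$.
   Context: All functions are real valued on $(-1,1)$; derivatives are understood in the sense of distributions on $(-1,1)$. Let $\omega(t)=\sqrt{1-t^2}$. Legendre polynomials: $P_n(t)=\frac{(-1)^n}{2^n n!}\frac{d^n}{dt^n}\big((1-t^2)^n\big)$, $n\ge 0$. For integers $0\le m\le n$, the normalized associated Legendre functions are $Q_n^m:=c_{n,m}\,\omega^m P_n^{(m)}$ with $c_{n,m}=\left(\frac{2n+1}{2}\frac{(n-m)!}{(n+m)!}\right)^{1/2}$; for each fixed $m\ge0$, $\{Q_n^m : n\ge m\}$ is an orthonormal basis of $L^2(-1,1)$. For integer $m\ge 0$ and real $s\ge 0$, $H_m^s$ is the set of $u\in L^2(-1,1)$ with $\|u\|_{m,s}^2:=\sum_{n=m}^\infty (2n+1)^{2s}|(u,Q_n^m)_{L^2(-1,1)}|^2<\infty$. $Y:=\{u:(-1,1)\to\mathbb R : \omega^{-1}u\in L^2(-1,1),\ \omega u'\in L^2(-1,1)\}$, with norm $\left(\int_{-1}^1\omega^2|u'|^2+\int_{-1}^1\omega^{-2}|u|^2\right)^{1/2}$. *)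

theory Defs
  imports "HOL-Analysis.Analysis"
begin

(* A function on (-1,1) is a total function real => real whose values outside (-1,1) are ignored.
   The sets L2, H_space m s and Y_space below depend only on the restriction to (-1,1), up to null sets; they
   consist of all representatives, so that equality of such sets is the same as equality of the
   corresponding sets of almost-everywhere classes. *)

abbreviation open_ivl :: "real set" where
  "open_ivl \<equiv> {-1<..<1}"

definition L2 :: "(real \<Rightarrow> real) set" where
  "L2 = {u. u \<in> borel_measurable (lebesgue_on open_ivl) \<and> integrable (lebesgue_on open_ivl) (\<lambda>t. (u t)\<^sup>2)}"

definition L2_inner :: "(real \<Rightarrow> real) \<Rightarrow> (real \<Rightarrow> real) \<Rightarrow> real" where
  "L2_inner u v = (LINT t|lebesgue_on open_ivl. u t * v t)"

definition \<omega> :: "real \<Rightarrow> real" where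
  "\<omega> t = sqrt (1 - t\<^sup>2)"

definition legendre_P :: "nat \<Rightarrow> real \<Rightarrow> real" where
  "legendre_P n t = (-1) ^ n / (2 ^ n * fact n) * (deriv ^^ n) (\<lambda>x. (1 - x\<^sup>2) ^ n) t"

(* assoc_c and assoc_Q are only meaningful for m \<le> n (otherwise n - m is truncated). *)

definition assoc_c :: "nat \<Rightarrow> nat \<Rightarrow> real" where
  "assoc_c n m = sqrt (real (2 * n + 1) / 2 * (fact (n - m) / fact (n + m)))"

definition assoc_Q :: "nat \<Rightarrow> nat \<Rightarrow> real \<Rightarrow> real" where
  "assoc_Q n m t = assoc_c n m * \<omega> t ^ m * (deriv ^^ m) (legendre_P n) t"

definition H_space :: "nat \<Rightarrow> real \<Rightarrow> (real \<Rightarrow> real) set" where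
  "H_space m s = {u \<in> L2. (\<lambda>n. real (2 * n + 1) powr (2 * s) * (L2_inner u (assoc_Q n m))\<^sup>2) summable_on {m..}}"

definition test_function :: "(real \<Rightarrow> real) \<Rightarrow> bool" where
  "test_function \<phi> \<longleftrightarrow>
     (\<forall>k t. (deriv ^^ k) \<phi> differentiable (at t)) \<and>
     compact (closure {t. \<phi> t \<noteq> 0}) \<and> closure {t. \<phi> t \<noteq> 0} \<subseteq> open_ivl"

definition locally_integrable :: "(real \<Rightarrow> real) \<Rightarrow> bool" where
  "locally_integrable u \<longleftrightarrow> (\<forall>K. compact K \<and> K \<subseteq> open_ivl \<longrightarrow> integrable (lebesgue_on K) u)"

(* The distribution u' on (-1,1) is given by the locally integrable function v. *)

definition distributional_deriv :: "(real \<Rightarrow> real) \<Rightarrow> (real \<Rightarrow> real) \<Rightarrow> bool" where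
  "distributional_deriv u v \<longleftrightarrow>
     locally_integrable u \<and> locally_integrable v \<and>
     (\<forall>\<phi>. test_function \<phi> \<longrightarrow>
        (LINT t|lebesgue_on open_ivl. u t * deriv \<phi> t) = - (LINT t|lebesgue_on open_ivl. v t * \<phi> t))"

(* \<omega> is smooth and positive on (-1,1) and 1 / \<omega> is locally bounded there, so the distribution
   \<omega> u' lies in L2 exactly when u' is given by a locally integrable v with \<omega> v in L2. *)

definition Y_space :: "(real \<Rightarrow> real) set" where
  "Y_space = {u. (\<lambda>t. inverse (\<omega> t) * u t) \<in> L2 \<and>
           (\<exists>v. distributional_deriv u v \<and> (\<lambda>t. \<omega> t * v t) \<in> L2)}"

end

theory Submission
  imports Defs
begin

text \<open>
  The space \<open>Y\<close> is the form domain of the singular Sturm--Liouville operator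
  \<open>L u = - (\<omega>\<^sup>2 u')' + m\<^sup>2 \<omega>\<^bsup>-2\<^esup> u\<close>, of which the \<open>Q\<^sub>n\<close> (with \<open>m\<close> fixed) are the
  eigenfunctions with eigenvalues \<open>n (n + 1)\<close>. For \<open>m \<ge> 1\<close> the energy
  \<open>\<parallel>\<omega> u'\<parallel>\<^sup>2 + m\<^sup>2 \<parallel>u / \<omega>\<parallel>\<^sup>2\<close> is equivalent to the square of the norm of \<open>Y\<close>, and on an expansion
  \<open>u = \<Sum> c\<^sub>n Q\<^sub>n\<close> it equals \<open>\<Sum> n (n + 1) c\<^sub>n\<^sup>2\<close>, which is comparable to
  \<open>\<Sum> (2 n + 1)\<^sup>2 c\<^sub>n\<^sup>2\<close> as \<open>n \<ge> m \<ge> 1\<close>.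

  On the Legendre side everything is polynomial. Writing \<open>Q = \<omega>\<^sup>m p\<close>, one has
  \<open>\<omega>\<^sup>2 Q' = \<omega>\<^sup>m D p\<close> with \<open>D p = (1 - t\<^sup>2) p' - m t p\<close>, and Legendre's equation becomes
  \<open>D (D p) = m\<^sup>2 p - n (n + 1) (1 - t\<^sup>2) p\<close> (lemma \<open>ang_deriv_ang_deriv_assoc_poly\<close>). So the pairs
  \<open>(\<omega> Q', Q / \<omega>)\<close>, which have only the non-negative power \<open>\<omega>\<^bsup>m-1\<^esup>\<close> in front of a polynomial, are
  orthogonal for the energy form (\<open>assoc_Q_energy\<close>).

  \<^item> \<open>Y \<subseteq> H\<close> is Bessel's inequality for these pairs. It needs the weak form of the eigenvalue
    equation, that is, a weak derivative tested against \<open>\<omega>\<^sup>m q\<close>, which vanishes at \<open>\<plusminus>1\<close> but is not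
    compactly supported. Multiplication by the smooth cut-offs \<open>exp (- d / (\<omega>\<^sup>2 - d))\<close> and \<open>d \<rightarrow> 0\<close>
    gives it (\<open>weak_derivative_against_omega_power\<close>).
  \<^item> \<open>H \<subseteq> Y\<close>: the partial sums are Cauchy in the energy, hence \<open>\<omega> S\<^sub>N'\<close> and \<open>S\<^sub>N / \<omega>\<close> converge in
    \<open>L\<^sup>2\<close> (\<open>L2_complete\<close>). The limit of \<open>S\<^sub>N\<close> is \<open>u\<close> because the \<open>Q\<^sub>n\<close> are complete
    (\<open>assoc_Q_complete\<close>, by the Weierstrass theorem), and integration by parts passes to the limit.

  For \<open>m = 0\<close> the term \<open>u / \<omega>\<close> is missing from the energy, and the constant function \<open>1\<close>, a multiple of
  \<open>Q\<^sub>0\<close>, lies in \<open>H\<close> although \<open>1 / \<omega>\<close> is not square integrable.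
\<close>

section \<open>Legendre polynomials and their differential equation\<close>

definition one_minus_sq :: "real poly" where
  "one_minus_sq = [:1, 0, -1:]"

definition legendre_poly :: "nat \<Rightarrow> real poly" where
  "legendre_poly n = smult ((-1) ^ n / (2 ^ n * fact n)) ((pderiv ^^ n) (one_minus_sq ^ n))"

text \<open>
  The polynomial factor of the associated Legendre function, normalisation included.
\<close>

definition assoc_poly :: "nat \<Rightarrow> nat \<Rightarrow> real poly" where
  "assoc_poly n m = smult (assoc_c n m) ((pderiv ^^ m) (legendre_poly n))"

text \<open>
  The polynomial \<open>D p\<close> with \<open>\<omega>\<^sup>2 (\<omega>\<^sup>m p)' = \<omega>\<^sup>m D p\<close>.
\<close>

definition ang_deriv :: "nat \<Rightarrow> real poly \<Rightarrow> real poly" where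
  "ang_deriv m p = one_minus_sq * pderiv p - smult (real m) ([:0, 1:] * p)"

lemma poly_ext: "(\<And>t. poly p t = poly q t) \<Longrightarrow> p = q" for p q :: "real poly"
  by (simp add: poly_eq_poly_eq_iff[symmetric] fun_eq_iff)

lemma poly_one_minus_sq [simp]: "poly one_minus_sq t = 1 - t\<^sup>2"
  by (simp add: one_minus_sq_def power2_eq_square)

lemma pderiv_one_minus_sq [simp]: "pderiv one_minus_sq = [:0, -2:]"
  by (simp add: one_minus_sq_def pderiv_pCons)

lemma degree_one_minus_sq [simp]: "degree one_minus_sq = 2"
  by (simp add: one_minus_sq_def)

lemma one_minus_sq_neq_0 [simp]: "one_minus_sq \<noteq> 0"
  by (simp add: one_minus_sq_def)

lemma higher_deriv_poly: "(deriv ^^ k) (poly p) = poly ((pderiv ^^ k) p)" for p :: "real poly"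
proof (induction k)
  case (Suc k)
  have "deriv (poly q) = poly (pderiv q)" for q :: "real poly"
    by (rule ext) (simp add: DERIV_imp_deriv)
  with Suc show ?case by simp
qed simp

lemma legendre_P_eq_poly: "legendre_P n = poly (legendre_poly n)"
proof
  fix t
  have "(\<lambda>x::real. (1 - x\<^sup>2) ^ n) = poly (one_minus_sq ^ n)"
    by (simp add: fun_eq_iff poly_power power2_eq_square)
  then show "legendre_P n t = poly (legendre_poly n) t"
    by (simp only: legendre_P_def legendre_poly_def higher_deriv_poly poly_smult)
qed

lemma assoc_Q_eq_poly: "assoc_Q n m t = \<omega> t ^ m * poly (assoc_poly n m) t"
  by (simp add: assoc_Q_def assoc_poly_def legendre_P_eq_poly higher_deriv_poly)

text \<open>
  The power \<open>w = (1 - x\<^sup>2) ^ n\<close> satisfies \<open>(1 - x\<^sup>2) w' = - 2 n x w\<close>; this is the \<open>k + 1\<close>-fold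
  derivative of that equation, obtained by differentiating once per induction step.
\<close>

lemma Rodrigues_ode:
  fixes n k :: nat
  defines "w \<equiv> one_minus_sq ^ n"
  shows "one_minus_sq * (pderiv ^^ (k + 2)) w
           + smult (2 * (real n - real k - 1)) ([:0, 1:] * (pderiv ^^ (k + 1)) w)
           + smult ((real k + 1) * (2 * real n - real k)) ((pderiv ^^ k) w) = 0"
proof (induction k)
  case 0
  have first: "one_minus_sq * pderiv w = smult (- 2 * real n) ([:0, 1:] * w)"
  proof (cases n)
    case (Suc l)
    have "pderiv w = smult (real n) (one_minus_sq ^ l) * [:0, -2:]"
      by (simp only: w_def Suc pderiv_power_Suc pderiv_one_minus_sq)
    then have "poly (pderiv w) t = real n * (1 - t\<^sup>2) ^ l * (- 2 * t)" for t
      by simp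
    moreover have "poly w t = (1 - t\<^sup>2) * (1 - t\<^sup>2) ^ l" for t
      by (simp add: w_def Suc)
    ultimately have "poly (one_minus_sq * pderiv w) t = poly (smult (- 2 * real n) ([:0, 1:] * w)) t" for t
      by (simp add: Suc) (simp add: algebra_simps)
    then show ?thesis by (rule poly_ext)
  qed (simp add: w_def)
  have "poly (pderiv (one_minus_sq * pderiv w)) t = poly (pderiv (smult (- 2 * real n) ([:0, 1:] * w))) t" for t
    by (simp only: first)
  then have "(1 - t\<^sup>2) * poly (pderiv (pderiv w)) t - 2 * t * poly (pderiv w) t
              = - 2 * real n * (poly w t + t * poly (pderiv w) t)" for t
    by (simp only: pderiv_mult pderiv_smult pderiv_pCons pderiv_one_minus_sq poly_add poly_mult poly_smult
         poly_one_minus_sq) (simp add: algebra_simps)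
  then show ?case
    by (intro poly_ext) (simp add: algebra_simps)
next
  case (Suc k)
  define f where "f = (pderiv ^^ k) w"
  have "poly (pderiv (one_minus_sq * pderiv (pderiv f)
           + smult (2 * (real n - real k - 1)) ([:0, 1:] * pderiv f)
           + smult ((real k + 1) * (2 * real n - real k)) f)) t = 0" for t
    using Suc by (simp add: f_def del: mult_pCons_left mult_pCons_right)
  then have "(1 - t\<^sup>2) * poly (pderiv (pderiv (pderiv f))) t - 2 * t * poly (pderiv (pderiv f)) t
      + 2 * (real n - real k - 1) * (poly (pderiv f) t + t * poly (pderiv (pderiv f)) t)
      + (real k + 1) * (2 * real n - real k) * poly (pderiv f) t = 0" for t
    by (simp only: pderiv_mult pderiv_smult pderiv_pCons pderiv_add pderiv_one_minus_sq poly_add poly_mult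
         poly_smult poly_one_minus_sq) (simp add: algebra_simps)
  then have "poly (one_minus_sq * pderiv (pderiv (pderiv f))
           + smult (2 * (real n - real (Suc k) - 1)) ([:0, 1:] * pderiv (pderiv f))
           + smult ((real (Suc k) + 1) * (2 * real n - real (Suc k))) (pderiv f)) t = 0" for t
    by (simp add: algebra_simps)
  then show ?case
    by (intro poly_ext) (simp add: f_def)
qed

text \<open>
  The case \<open>k = n + m\<close> of the previous equation, since the \<open>m\<close>-th derivative of \<open>P\<^sub>n\<close> is a multiple of
  the \<open>n + m\<close>-th derivative of \<open>(1 - x\<^sup>2) ^ n\<close>.
\<close>

lemma Legendre_ode:
  fixes n m :: nat
  defines "r \<equiv> (pderiv ^^ m) (legendre_poly n)"
  shows "one_minus_sq * pderiv (pderiv r) - smult (2 * (real m + 1)) ([:0, 1:] * pderiv r)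
           + smult ((real n - real m) * (real n + real m + 1)) r = 0"
proof -
  define w where "w = (pderiv ^^ (m + n)) (one_minus_sq ^ n)"
  define c :: real where "c = (-1) ^ n / (2 ^ n * fact n)"
  have r: "r = smult c w"
    by (simp add: r_def w_def c_def legendre_poly_def higher_pderiv_smult funpow_add)
  have "one_minus_sq * pderiv (pderiv w) - smult (2 * (real m + 1)) ([:0, 1:] * pderiv w)
           + smult ((real n - real m) * (real n + real m + 1)) w = 0"
    using Rodrigues_ode[of "m + n" n]
    by (simp add: w_def poly_eq_poly_eq_iff[symmetric] fun_eq_iff) (simp add: algebra_simps)
  then have "smult c (one_minus_sq * pderiv (pderiv w) - smult (2 * (real m + 1)) ([:0, 1:] * pderiv w)
           + smult ((real n - real m) * (real n + real m + 1)) w) = 0"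
    by simp
  then show ?thesis
    by (simp add: r pderiv_smult smult_add_right smult_diff_right mult_ac)
qed

text \<open>
  Legendre's equation as the eigenvalue equation for \<open>(\<omega>\<^sup>2 d/dt)\<^sup>2\<close>, written for the polynomial factor
  of \<open>\<omega>\<^sup>m p\<close>. This form avoids the negative powers of \<open>\<omega>\<close> in the differential operator.
\<close>

lemma ang_deriv_ang_deriv_assoc_poly:
  "ang_deriv m (ang_deriv m (assoc_poly n m))
     = smult ((real m)\<^sup>2) (assoc_poly n m) - smult (real n * (real n + 1)) (one_minus_sq * assoc_poly n m)"
proof -
  define r where "r = (pderiv ^^ m) (legendre_poly n)"
  have "poly (one_minus_sq * pderiv (pderiv r) - smult (2 * (real m + 1)) ([:0, 1:] * pderiv r)
           + smult ((real n - real m) * (real n + real m + 1)) r) t = 0" for t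
    using Legendre_ode[of m n] by (simp add: r_def)
  then have ode: "(1 - t\<^sup>2) * poly (pderiv (pderiv r)) t
       = 2 * (real m + 1) * (t * poly (pderiv r) t) - (real n - real m) * (real n + real m + 1) * poly r t" for t
    by (simp add: algebra_simps power2_eq_square)
  have "poly (ang_deriv m (ang_deriv m r)) t =
     poly (smult ((real m)\<^sup>2) r - smult (real n * (real n + 1)) (one_minus_sq * r)) t" for t
  proof -
    have "poly (ang_deriv m (ang_deriv m r)) t =
       (1 - t\<^sup>2) * ((1 - t\<^sup>2) * poly (pderiv (pderiv r)) t - 2 * t * poly (pderiv r) t
           - m * (poly r t + t * poly (pderiv r) t))
       - m * (t * ((1 - t\<^sup>2) * poly (pderiv r) t - m * (t * poly r t)))"
      by (simp add: ang_deriv_def pderiv_diff pderiv_mult pderiv_smult pderiv_pCons)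
         (simp add: algebra_simps power2_eq_square)
    then show ?thesis
      unfolding ode by (simp add: algebra_simps power2_eq_square)
  qed
  then have "ang_deriv m (ang_deriv m r) =
     smult ((real m)\<^sup>2) r - smult (real n * (real n + 1)) (one_minus_sq * r)"
    by (simp add: poly_eq_poly_eq_iff[symmetric] fun_eq_iff)
  moreover have "ang_deriv m (smult c p) = smult c (ang_deriv m p)" for c p
    by (simp add: ang_deriv_def pderiv_smult smult_diff_right mult_ac)
  ultimately show ?thesis
    by (simp add: assoc_poly_def r_def[symmetric] smult_diff_right mult_ac)
qed

lemma degree_legendre_poly: "degree (legendre_poly n) = n"
  by (simp add: legendre_poly_def degree_higher_pderiv degree_power_eq)

lemma coeff_one_minus_sq_power: "coeff (one_minus_sq ^ n) (2 * n) = (-1) ^ n"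
proof -
  have "degree (one_minus_sq ^ n) = 2 * n" by (simp add: degree_power_eq)
  moreover have "lead_coeff one_minus_sq = -1" by (simp add: one_minus_sq_def)
  ultimately show ?thesis using lead_coeff_power[of one_minus_sq n] by simp
qed

lemma degree_assoc_poly:
  assumes "m \<le> n"
  shows "degree (assoc_poly n m) = n - m" and "assoc_poly n m \<noteq> 0"
proof -
  have "assoc_c n m \<noteq> 0" by (simp add: assoc_c_def)
  then show "degree (assoc_poly n m) = n - m"
    by (simp add: assoc_poly_def degree_higher_pderiv degree_legendre_poly)
  have "legendre_poly n \<noteq> 0"
  proof -
    have "coeff ((pderiv ^^ n) (one_minus_sq ^ n)) n \<noteq> 0"
      using coeff_one_minus_sq_power[of n]
      by (simp add: coeff_higher_pderiv mult_2[symmetric] pochhammer_eq_0_iff)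
    then show ?thesis by (auto simp: legendre_poly_def)
  qed
  have "coeff ((pderiv ^^ m) (legendre_poly n)) (n - m) \<noteq> 0"
    using assms \<open>legendre_poly n \<noteq> 0\<close> leading_coeff_neq_0[of "legendre_poly n"]
    by (simp add: coeff_higher_pderiv degree_legendre_poly pochhammer_eq_0_iff)
  then show "assoc_poly n m \<noteq> 0"
    using \<open>assoc_c n m \<noteq> 0\<close> by (auto simp: assoc_poly_def)
qed

section \<open>Square integrable functions on the interval\<close>

abbreviation \<mu> :: "real measure" where
  "\<mu> \<equiv> lebesgue_on open_ivl"

interpretation \<mu>: finite_measure \<mu>
  by (rule finite_measure_lebesgue_on) (simp add: lmeasurable_interval)

lemma measurable_\<mu>_continuous:
  fixes f :: "real \<Rightarrow> real"
  assumes "continuous_on open_ivl f"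
  shows "f \<in> borel_measurable \<mu>"
  using assms by (intro continuous_imp_measurable_on_sets_lebesgue) auto

lemma integrable_\<mu>_bounded:
  fixes f :: "real \<Rightarrow> real"
  assumes "f \<in> borel_measurable \<mu>" "\<And>t. t \<in> open_ivl \<Longrightarrow> \<bar>f t\<bar> \<le> C"
  shows "integrable \<mu> f"
  using assms by (intro \<mu>.integrable_const_bound[of _ C] AE_I2) auto

lemma continuous_on_ivl_bounded:
  fixes f :: "real \<Rightarrow> real"
  assumes "continuous_on {-1..1} f"
  obtains C where "\<And>t. t \<in> {-1..1} \<Longrightarrow> \<bar>f t\<bar> \<le> C"
proof -
  have "bounded (f ` {-1..1})"
    using assms compact_continuous_image compact_imp_bounded by blast
  then obtain C where "\<forall>y\<in>f ` {-1..1}. norm y \<le> C"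
    unfolding bounded_iff by blast
  then show thesis by (intro that[of C]) auto
qed

lemma integrable_\<mu>_continuous:
  fixes f :: "real \<Rightarrow> real"
  assumes "continuous_on {-1..1} f"
  shows "integrable \<mu> f"
proof -
  obtain C where "\<And>t. t \<in> {-1..1} \<Longrightarrow> \<bar>f t\<bar> \<le> C"
    using continuous_on_ivl_bounded[OF assms] by blast
  then show ?thesis
    by (intro integrable_\<mu>_bounded[of _ C] measurable_\<mu>_continuous continuous_on_subset[OF assms]) auto
qed

lemma integral_\<mu>_derivative:
  fixes f F :: "real \<Rightarrow> real"
  assumes "integrable \<mu> f" "\<And>t. t \<in> {-1..1} \<Longrightarrow> (F has_real_derivative f t) (at t)"
  shows "integral\<^sup>L \<mu> f = F 1 - F (-1)"
proof -
  have "(f has_integral (F 1 - F (-1))) {-1..1}"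
    by (intro fundamental_theorem_of_calculus)
       (use assms(2) in \<open>auto simp: has_real_derivative_iff_has_vector_derivative[symmetric]
          intro: has_field_derivative_at_within\<close>)
  then have "integral open_ivl f = F 1 - F (-1)"
    by (simp add: has_integral_Icc_iff_Ioo integral_unique)
  then show ?thesis
    using lebesgue_integral_eq_integral[OF assms(1)] by simp
qed

lemma integrable_poly: "integrable \<mu> (poly p)" for p :: "real poly"
  by (intro integrable_\<mu>_continuous continuous_intros)

lemma integral_pderiv: "integral\<^sup>L \<mu> (poly (pderiv p)) = poly p 1 - poly p (-1)"
  by (intro integral_\<mu>_derivative integrable_poly) simp

lemma L2D:
  assumes "u \<in> L2"
  shows "u \<in> borel_measurable \<mu>" "integrable \<mu> (\<lambda>t. u t * u t)"
  using assms by (auto simp: L2_def power2_eq_square)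

lemma L2I:
  assumes "u \<in> borel_measurable \<mu>" "integrable \<mu> (\<lambda>t. u t * u t)"
  shows "u \<in> L2"
  using assms by (auto simp: L2_def power2_eq_square)

lemma L2_mult_integrable:
  assumes "u \<in> L2" "v \<in> L2"
  shows "integrable \<mu> (\<lambda>t. u t * v t)"
proof (rule Bochner_Integration.integrable_bound)
  show "integrable \<mu> (\<lambda>t. u t * u t + v t * v t)"
    using L2D assms by auto
  show "(\<lambda>t. u t * v t) \<in> borel_measurable \<mu>"
    using L2D assms by auto
  have "\<bar>x * y\<bar> \<le> \<bar>x * x + y * y\<bar>" for x y :: real
  proof -
    have "2 * \<bar>x * y\<bar> \<le> x * x + y * y"
      using sum_squares_bound[of "\<bar>x\<bar>" "\<bar>y\<bar>"] by (simp add: abs_mult power2_eq_square)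
    then show ?thesis by simp
  qed
  then show "AE t in \<mu>. norm (u t * v t) \<le> norm (u t * u t + v t * v t)"
    by simp
qed

lemma L2_bounded:
  assumes "u \<in> borel_measurable \<mu>" "\<And>t. t \<in> open_ivl \<Longrightarrow> \<bar>u t\<bar> \<le> C"
  shows "u \<in> L2"
proof (rule L2I)
  have "\<bar>u t * u t\<bar> \<le> C * C" if "t \<in> open_ivl" for t
    using assms(2)[OF that] mult_mono[of "\<bar>u t\<bar>" C "\<bar>u t\<bar>" C] by simp
  then show "integrable \<mu> (\<lambda>t. u t * u t)"
    using assms(1) by (intro integrable_\<mu>_bounded) auto
qed fact

lemma L2_continuous:
  assumes "continuous_on {-1..1} u"
  shows "u \<in> L2"
  using assms by (intro L2I integrable_\<mu>_continuous measurable_\<mu>_continuous continuous_intros continuous_on_subset[OF assms]) auto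

lemma L2_mult_bounded:
  assumes "u \<in> L2" "b \<in> borel_measurable \<mu>" "\<And>t. t \<in> open_ivl \<Longrightarrow> \<bar>b t\<bar> \<le> C"
  shows "(\<lambda>t. b t * u t) \<in> L2"
proof (rule L2I)
  show "integrable \<mu> (\<lambda>t. b t * u t * (b t * u t))"
  proof (rule Bochner_Integration.integrable_bound)
    show "integrable \<mu> (\<lambda>t. C * C * (u t * u t))"
      using L2D assms by auto
    have "norm (b t * u t * (b t * u t)) \<le> norm (C * C * (u t * u t))" if "t \<in> open_ivl" for t
    proof -
      have "b t * b t \<le> C * C"
        using assms(3)[OF that] mult_mono[of "\<bar>b t\<bar>" C "\<bar>b t\<bar>" C] by simp
      then have "b t * b t * (u t * u t) \<le> C * C * (u t * u t)"
        by (intro mult_right_mono) auto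
      moreover have "0 \<le> b t * b t * (u t * u t)" "0 \<le> C * C * (u t * u t)"
        by simp_all
      ultimately show ?thesis by (simp add: mult_ac)
    qed
    then show "AE t in \<mu>. norm (b t * u t * (b t * u t)) \<le> norm (C * C * (u t * u t))"
      by (intro AE_I2) auto
  qed (use L2D assms in auto)
qed (use L2D assms in auto)

lemma L2_1: "(\<lambda>t. 1) \<in> L2"
  by (intro L2_continuous continuous_intros)

lemma L2_imp_integrable: "u \<in> L2 \<Longrightarrow> integrable \<mu> u"
  using L2_mult_integrable[OF _ L2_1] by simp

lemma L2_scale: "u \<in> L2 \<Longrightarrow> (\<lambda>t. c * u t) \<in> L2"
  by (rule L2_mult_bounded[where C = "\<bar>c\<bar>"]) auto

lemma L2_add:
  assumes "u \<in> L2" "v \<in> L2"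
  shows "(\<lambda>t. u t + v t) \<in> L2"
proof (rule L2I)
  have "integrable \<mu> (\<lambda>t. u t * u t + 2 * (u t * v t) + v t * v t)"
    using L2D assms L2_mult_integrable by auto
  then show "integrable \<mu> (\<lambda>t. (u t + v t) * (u t + v t))"
    by (simp add: algebra_simps)
qed (use L2D assms in auto)

lemma L2_diff:
  assumes "u \<in> L2" "v \<in> L2"
  shows "(\<lambda>t. u t - v t) \<in> L2"
  using L2_add[OF assms(1) L2_scale[OF assms(2), of "-1"]] by simp

lemma L2_sum:
  assumes "\<And>i. i \<in> A \<Longrightarrow> f i \<in> L2"
  shows "(\<lambda>t. \<Sum>i\<in>A. f i t) \<in> L2"
  using assms
proof (induction A rule: infinite_finite_induct)
  case (insert x F)
  then show ?case using L2_add[of "f x"] by simp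
qed (simp_all add: L2_scale[OF L2_1, of 0, simplified])

lemma L2_cong:
  assumes "\<And>t. t \<in> open_ivl \<Longrightarrow> u t = v t"
  shows "u \<in> L2 \<longleftrightarrow> v \<in> L2"
proof -
  have "u \<in> borel_measurable \<mu> \<longleftrightarrow> v \<in> borel_measurable \<mu>"
    by (intro measurable_cong) (use assms in auto)
  moreover have "integrable \<mu> (\<lambda>t. u t * u t) \<longleftrightarrow> integrable \<mu> (\<lambda>t. v t * v t)"
    by (intro Bochner_Integration.integrable_cong refl) (use assms in auto)
  ultimately show ?thesis
    using L2D L2I by blast
qed

lemma L2_cong_AE:
  assumes "u \<in> L2" "v \<in> borel_measurable \<mu>" "AE t in \<mu>. u t = v t"
  shows "v \<in> L2"
proof (rule L2I)
  have "AE t in \<mu>. u t * u t = v t * v t" using assms(3) by eventually_elim auto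
  then show "integrable \<mu> (\<lambda>t. v t * v t)"
    using assms L2D[OF assms(1)] integrable_cong_AE_imp[of \<mu> "\<lambda>t. u t * u t" "\<lambda>t. v t * v t"]
    by (auto elim: eventually_mono)
qed fact

lemma L2_inner_commute: "L2_inner u v = L2_inner v u"
  by (simp add: L2_inner_def mult.commute)

lemma L2_inner_diff_left:
  assumes "u \<in> L2" "v \<in> L2" "w \<in> L2"
  shows "L2_inner (\<lambda>t. u t - v t) w = L2_inner u w - L2_inner v w"
  using assms by (simp add: L2_inner_def left_diff_distrib L2_mult_integrable)

lemma L2_inner_scale_left: "L2_inner (\<lambda>t. c * u t) v = c * L2_inner u v"
  by (simp add: L2_inner_def mult.assoc)

lemma L2_inner_sum_left:
  assumes "\<And>i. i \<in> A \<Longrightarrow> f i \<in> L2" "v \<in> L2"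
  shows "L2_inner (\<lambda>t. \<Sum>i\<in>A. f i t) v = (\<Sum>i\<in>A. L2_inner (f i) v)"
  using assms by (simp add: L2_inner_def sum_distrib_right L2_mult_integrable)

lemma L2_inner_self_nonneg: "0 \<le> L2_inner u u"
  by (simp add: L2_inner_def)

lemma L2_inner_cong:
  assumes "\<And>t. t \<in> open_ivl \<Longrightarrow> u t * v t = u' t * v' t"
  shows "L2_inner u v = L2_inner u' v'"
  unfolding L2_inner_def using assms by (intro Bochner_Integration.integral_cong) auto

text \<open>
  The usual discriminant argument; the case of a null vector \<open>v\<close> needs its own choice of the
  parameter.
\<close>

lemma L2_Cauchy_Schwarz:
  assumes u: "u \<in> L2" and v: "v \<in> L2"
  shows "(L2_inner u v)\<^sup>2 \<le> L2_inner u u * L2_inner v v"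
proof -
  have quad: "0 \<le> L2_inner u u - 2 * c * L2_inner u v + c\<^sup>2 * L2_inner v v" for c
  proof -
    have expand: "(u t - c * v t)\<^sup>2 = u t * u t - 2 * c * (u t * v t) + c\<^sup>2 * (v t * v t)" for t
      by (simp add: power2_eq_square algebra_simps)
    have "0 \<le> (LINT t|\<mu>. (u t - c * v t)\<^sup>2)" by simp
    also have "\<dots> = (LINT t|\<mu>. u t * u t - 2 * c * (u t * v t) + c\<^sup>2 * (v t * v t))"
      by (simp only: expand)
    also have "\<dots> = L2_inner u u - 2 * c * L2_inner u v + c\<^sup>2 * L2_inner v v"
      using u v by (simp add: L2_inner_def L2_mult_integrable)
    finally show ?thesis .
  qed
  show ?thesis
  proof (cases "L2_inner v v = 0")
    case True
    have "L2_inner u v = 0"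
    proof (rule ccontr)
      assume "L2_inner u v \<noteq> 0"
      then have "2 * ((L2_inner u u + 1) / (2 * L2_inner u v)) * L2_inner u v = L2_inner u u + 1"
        by simp
      \<comment> \<open>With a vanishing quadratic term, this slope makes the expression equal to \<open>-1\<close>.\<close>
      with quad[of "(L2_inner u u + 1) / (2 * L2_inner u v)"] True show False by simp
    qed
    with True show ?thesis by simp
  next
    case False
    then have pos: "0 < L2_inner v v" using L2_inner_self_nonneg[of v] by simp
    have "0 \<le> L2_inner u u - (L2_inner u v)\<^sup>2 / L2_inner v v"
    proof -
      define a b where "a = L2_inner u v" and "b = L2_inner v v"
      have "2 * (a / b) * a = 2 * (a\<^sup>2 / b)" "(a / b)\<^sup>2 * b = a\<^sup>2 / b"
        using pos by (auto simp: b_def power2_eq_square)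
      then show ?thesis
        using quad[of "a / b"] unfolding a_def b_def by linarith
    qed
    with pos show ?thesis by (simp add: pos_divide_le_eq)
  qed
qed

lemma L2_tendsto_inner:
  assumes "\<And>n. f n \<in> L2" "g \<in> L2" "h \<in> L2"
    and "(\<lambda>n. L2_inner (\<lambda>t. f n t - g t) (\<lambda>t. f n t - g t)) \<longlonglongrightarrow> 0"
  shows "(\<lambda>n. L2_inner (f n) h) \<longlonglongrightarrow> L2_inner g h"
proof -
  have "(\<lambda>n. (L2_inner (f n) h - L2_inner g h)\<^sup>2) \<longlonglongrightarrow> 0"
  proof (rule tendsto_sandwich[OF _ _ tendsto_const])
    show "(\<lambda>n. L2_inner (\<lambda>t. f n t - g t) (\<lambda>t. f n t - g t) * L2_inner h h) \<longlonglongrightarrow> 0"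
      using tendsto_mult_left_zero[OF assms(4)] .
    show "\<forall>\<^sub>F n in sequentially. (L2_inner (f n) h - L2_inner g h)\<^sup>2
            \<le> L2_inner (\<lambda>t. f n t - g t) (\<lambda>t. f n t - g t) * L2_inner h h"
      using L2_Cauchy_Schwarz[OF L2_diff[OF assms(1,2)] assms(3)] assms
      by (simp add: L2_inner_diff_left)
  qed simp
  then have "(\<lambda>n. L2_inner (f n) h - L2_inner g h) \<longlonglongrightarrow> 0"
    by simp
  then show ?thesis by (simp add: LIM_zero_iff)
qed

text \<open>
  On a finite measure space a Cauchy sequence in \<open>L\<^sup>2\<close> is Cauchy in \<open>L\<^sup>1\<close>, hence has an almost
  everywhere convergent subsequence, whose limit is the limit in \<open>L\<^sup>2\<close> by Fatou's lemma.
\<close>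

lemma L2_complete:
  fixes f :: "nat \<Rightarrow> real \<Rightarrow> real"
  assumes f: "\<And>n. f n \<in> L2"
    and cauchy: "\<And>e. 0 < e \<Longrightarrow> \<exists>N. \<forall>i\<ge>N. \<forall>j\<ge>N. L2_inner (\<lambda>t. f i t - f j t) (\<lambda>t. f i t - f j t) < e"
  obtains g where "g \<in> L2" "(\<lambda>n. L2_inner (\<lambda>t. f n t - g t) (\<lambda>t. f n t - g t)) \<longlonglongrightarrow> 0"
proof -
  have [measurable]: "f n \<in> borel_measurable \<mu>" for n using L2D f by auto
  have L1_cauchy: "\<exists>N. \<forall>i\<ge>N. \<forall>j\<ge>N. (LINT t|\<mu>. norm (f i t - f j t)) < e" if "0 < e" for e
  proof -
    define c where "c = L2_inner (\<lambda>t. 1) (\<lambda>t. 1) + 1"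
    have "c > 0" using L2_inner_self_nonneg[of "\<lambda>t. 1"] by (simp add: c_def)
    then obtain N where N: "\<And>i j. i \<ge> N \<Longrightarrow> j \<ge> N \<Longrightarrow> L2_inner (\<lambda>t. f i t - f j t) (\<lambda>t. f i t - f j t) < e\<^sup>2 / c"
      using cauchy[of "e\<^sup>2 / c"] \<open>0 < e\<close> by auto
    have "(LINT t|\<mu>. norm (f i t - f j t)) < e" if "i \<ge> N" "j \<ge> N" for i j
    proof -
      define d where "d = (\<lambda>t. f i t - f j t)"
      have d: "d \<in> L2" using L2_diff f by (simp add: d_def)
      have "(\<lambda>t. \<bar>d t\<bar>) \<in> L2" using d L2D[OF d] by (intro L2I) auto
      then have "(L2_inner (\<lambda>t. \<bar>d t\<bar>) (\<lambda>t. 1))\<^sup>2 \<le> L2_inner (\<lambda>t. \<bar>d t\<bar>) (\<lambda>t. \<bar>d t\<bar>) * L2_inner (\<lambda>t. 1) (\<lambda>t. 1)"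
        by (rule L2_Cauchy_Schwarz[OF _ L2_1])
      also have "L2_inner (\<lambda>t. \<bar>d t\<bar>) (\<lambda>t. \<bar>d t\<bar>) = L2_inner d d"
        by (simp add: L2_inner_def)
      also have "L2_inner d d * L2_inner (\<lambda>t. 1) (\<lambda>t. 1) \<le> L2_inner d d * c"
        using L2_inner_self_nonneg by (intro mult_left_mono) (auto simp: c_def)
      also have "\<dots> < e\<^sup>2"
        using N[OF that] \<open>c > 0\<close> by (simp add: d_def field_simps)
      finally show ?thesis
        using \<open>0 < e\<close> power2_less_imp_less[of "LINT t|\<mu>. \<bar>d t\<bar>" e] by (simp add: L2_inner_def d_def)
    qed
    then show ?thesis by blast
  qed
  obtain r where r: "strict_mono r" and AEC: "AE t in \<mu>. Cauchy (\<lambda>i. f (r i) t)"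
    by (rule cauchy_L1_AE_cauchy_subseq[OF L2_imp_integrable[OF f] L1_cauchy])
  define g where "g = (\<lambda>t. lim (\<lambda>i. f (r i) t))"
  have [measurable]: "g \<in> borel_measurable \<mu>"
    unfolding g_def by (rule borel_measurable_lim_metric) simp
  have lim: "AE t in \<mu>. (\<lambda>i. f (r i) t) \<longlonglongrightarrow> g t"
    using AEC by eventually_elim (simp add: g_def Cauchy_convergent_iff convergent_LIMSEQ_iff)
  \<comment> \<open>The subsequence only converges almost everywhere; Fatou's lemma turns this into an \<open>L\<^sup>2\<close>
    estimate for the whole sequence.\<close>
  have bound: "integrable \<mu> (\<lambda>t. (f n t - g t)\<^sup>2) \<and> (LINT t|\<mu>. (f n t - g t)\<^sup>2) \<le> e"
    if N: "\<And>i j. i \<ge> N \<Longrightarrow> j \<ge> N \<Longrightarrow> L2_inner (\<lambda>t. f i t - f j t) (\<lambda>t. f i t - f j t) < e"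
      and "n \<ge> N" for n N e
  proof -
    have "0 \<le> e" using N[OF \<open>n \<ge> N\<close> \<open>n \<ge> N\<close>] by (simp add: L2_inner_def)
    have "(\<integral>\<^sup>+t. ennreal ((f n t - g t)\<^sup>2) \<partial>\<mu>) = (\<integral>\<^sup>+t. liminf (\<lambda>i. ennreal ((f n t - f (r i) t)\<^sup>2)) \<partial>\<mu>)"
    proof (rule nn_integral_cong_AE)
      show "AE t in \<mu>. ennreal ((f n t - g t)\<^sup>2) = liminf (\<lambda>i. ennreal ((f n t - f (r i) t)\<^sup>2))"
        using lim
      proof eventually_elim
        case (elim t)
        have "(\<lambda>i. ennreal ((f n t - f (r i) t)\<^sup>2)) \<longlonglongrightarrow> ennreal ((f n t - g t)\<^sup>2)"
          by (intro tendsto_intros elim) 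
        from lim_imp_Liminf[OF sequentially_bot this] show ?case by simp
      qed
    qed
    also have "\<dots> \<le> liminf (\<lambda>i. \<integral>\<^sup>+t. ennreal ((f n t - f (r i) t)\<^sup>2) \<partial>\<mu>)"
      by (rule nn_integral_liminf) simp
    also have "\<dots> \<le> ennreal e"
    proof (rule Liminf_le)
      show "\<forall>\<^sub>F i in sequentially. (\<integral>\<^sup>+t. ennreal ((f n t - f (r i) t)\<^sup>2) \<partial>\<mu>) \<le> ennreal e"
        unfolding eventually_sequentially
      proof (intro exI[of _ N] allI impI)
        fix i assume "N \<le> i"
        then have "N \<le> r i" using seq_suble[OF r, of i] by simp
        have "(\<integral>\<^sup>+t. ennreal ((f n t - f (r i) t)\<^sup>2) \<partial>\<mu>) = ennreal (LINT t|\<mu>. (f n t - f (r i) t)\<^sup>2)"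
          using L2D(2)[OF L2_diff[OF f f]] by (intro nn_integral_eq_integral) (auto simp: power2_eq_square)
        also have "\<dots> \<le> ennreal e"
          using N[OF \<open>n \<ge> N\<close> \<open>N \<le> r i\<close>] by (intro ennreal_leI) (simp add: L2_inner_def power2_eq_square)
        finally show "(\<integral>\<^sup>+t. ennreal ((f n t - f (r i) t)\<^sup>2) \<partial>\<mu>) \<le> ennreal e" .
      qed
    qed simp
    finally have fin: "(\<integral>\<^sup>+t. ennreal ((f n t - g t)\<^sup>2) \<partial>\<mu>) \<le> ennreal e" .
    then have int: "integrable \<mu> (\<lambda>t. (f n t - g t)\<^sup>2)"
      by (intro integrableI_bounded) (auto simp: top_unique less_top[symmetric])
    then have "ennreal (LINT t|\<mu>. (f n t - g t)\<^sup>2) \<le> ennreal e"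
      using fin by (subst (asm) nn_integral_eq_integral) auto
    with int \<open>0 \<le> e\<close> show ?thesis by simp
  qed
  show thesis
  proof
    obtain N where N: "\<And>i j. i \<ge> N \<Longrightarrow> j \<ge> N \<Longrightarrow> L2_inner (\<lambda>t. f i t - f j t) (\<lambda>t. f i t - f j t) < 1"
      using cauchy[of 1] by auto
    have "(\<lambda>t. f N t - g t) \<in> L2"
      using bound[OF N, of N] by (intro L2I) (auto simp: power2_eq_square)
    from L2_diff[OF f[of N] this] show "g \<in> L2" by simp
    show "(\<lambda>n. L2_inner (\<lambda>t. f n t - g t) (\<lambda>t. f n t - g t)) \<longlonglongrightarrow> 0"
    proof (rule LIMSEQ_I)
      fix e :: real assume "0 < e"
      then obtain N where N: "\<And>i j. i \<ge> N \<Longrightarrow> j \<ge> N \<Longrightarrow> L2_inner (\<lambda>t. f i t - f j t) (\<lambda>t. f i t - f j t) < e / 2"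
        using cauchy[of "e / 2"] by auto
      have "L2_inner (\<lambda>t. f n t - g t) (\<lambda>t. f n t - g t) < e" if "n \<ge> N" for n
        using bound[OF N that] \<open>0 < e\<close> by (auto simp: L2_inner_def power2_eq_square)
      then show "\<exists>no. \<forall>n\<ge>no. norm (L2_inner (\<lambda>t. f n t - g t) (\<lambda>t. f n t - g t) - 0) < e"
        using L2_inner_self_nonneg by (intro exI[of _ N]) (auto simp: abs_of_nonneg)
    qed
  qed
qed

section \<open>Functions with vanishing moments\<close>

text \<open>
  By the Weierstrass theorem \<open>f\<close> integrates to zero against every continuous function. The sign of \<open>f\<close> is
  an almost everywhere limit of such functions, so by dominated convergence \<open>\<bar>f\<bar>\<close> integrates to zero.
\<close>

lemma AE_zero_if_moments_zero:
  assumes f: "integrable \<mu> f" and mom: "\<And>k. (LINT t|\<mu>. f t * t ^ k) = 0"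
  shows "AE t in \<mu>. f t = 0"
proof -
  have [measurable]: "f \<in> borel_measurable \<mu>" using f by simp
  have f_bounded: "integrable \<mu> (\<lambda>t. f t * g t)"
    if "g \<in> borel_measurable \<mu>" "\<And>t. t \<in> open_ivl \<Longrightarrow> \<bar>g t\<bar> \<le> C" for g C
  proof (rule Bochner_Integration.integrable_bound)
    show "integrable \<mu> (\<lambda>t. f t * C)" using f by simp
    have "norm (f t * g t) \<le> norm (f t * C)" if "t \<in> open_ivl" for t
      using \<open>\<And>t. t \<in> open_ivl \<Longrightarrow> \<bar>g t\<bar> \<le> C\<close>[OF that] by (simp add: abs_mult mult_left_mono)
    then show "AE t in \<mu>. norm (f t * g t) \<le> norm (f t * C)" by (intro AE_I2) auto
  qed (use that in simp)
  have f_cont: "integrable \<mu> (\<lambda>t. f t * g t)" if g: "continuous_on {-1..1} g" for g :: "real \<Rightarrow> real"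
  proof -
    obtain C where "\<And>t. t \<in> {-1..1} \<Longrightarrow> \<bar>g t\<bar> \<le> C"
      using continuous_on_ivl_bounded[OF g] by blast
    then show ?thesis
      by (intro f_bounded[of _ C] measurable_\<mu>_continuous continuous_on_subset[OF g]) auto
  qed
  have cont_zero: "(LINT t|\<mu>. f t * g t) = 0" if g: "continuous_on {-1..1} g" for g :: "real \<Rightarrow> real"
  proof -
    define B where "B = (LINT t|\<mu>. \<bar>f t\<bar>)"
    have "\<bar>LINT t|\<mu>. f t * g t\<bar> \<le> e * B" if "0 < e" for e
    proof -
      obtain q where q: "real_polynomial_function q" "\<And>t. t \<in> {-1..1} \<Longrightarrow> \<bar>g t - q t\<bar> < e"
        using Stone_Weierstrass_real_polynomial_function[OF _ g \<open>0 < e\<close>] by auto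
      obtain a n where qs: "q = (\<lambda>t. \<Sum>i\<le>n. a i * t ^ i)"
        using q(1) by (auto simp: real_polynomial_function_iff_sum)
      have "integrable \<mu> (\<lambda>t. a i * (f t * t ^ i))" for i
        by (intro integrable_mult_right f_cont continuous_intros)
      then have "(LINT t|\<mu>. f t * q t) = (\<Sum>i\<le>n. a i * (LINT t|\<mu>. f t * t ^ i))"
        by (simp add: qs sum_distrib_left mult.left_commute)
      then have q0: "(LINT t|\<mu>. f t * q t) = 0" by (simp add: mom)
      have qi: "continuous_on {-1..1} q" by (simp add: qs continuous_intros)
      have "(LINT t|\<mu>. f t * g t) = (LINT t|\<mu>. f t * g t - f t * q t)"
        using f_cont[OF g] f_cont[OF qi] q0 by simp
      also have "\<bar>\<dots>\<bar> \<le> (LINT t|\<mu>. \<bar>f t * g t - f t * q t\<bar>)"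
        using integral_norm_bound[of \<mu> "\<lambda>t. f t * g t - f t * q t"] by simp
      also have "\<dots> \<le> (LINT t|\<mu>. e * \<bar>f t\<bar>)"
      proof (rule integral_mono)
        show "integrable \<mu> (\<lambda>t. \<bar>f t * g t - f t * q t\<bar>)"
          using f_cont[OF g] f_cont[OF qi] by simp
        show "integrable \<mu> (\<lambda>t. e * \<bar>f t\<bar>)" using f by simp
        fix t assume "t \<in> space \<mu>"
        then have "\<bar>g t - q t\<bar> \<le> e" using q(2)[of t] by simp
        then show "\<bar>f t * g t - f t * q t\<bar> \<le> e * \<bar>f t\<bar>"
          by (metis abs_ge_zero abs_mult mult.commute mult_right_mono right_diff_distrib)
      qed
      finally show ?thesis by (simp add: B_def)
    qed
    note small = this
    have "B \<ge> 0" by (simp add: B_def)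
    have "\<bar>LINT t|\<mu>. f t * g t\<bar> \<le> 0"
    proof (rule field_le_epsilon)
      fix e :: real assume "0 < e"
      have "\<bar>LINT t|\<mu>. f t * g t\<bar> \<le> e / (B + 1) * B"
        using \<open>0 < e\<close> \<open>B \<ge> 0\<close> by (intro small) simp
      also have "\<dots> \<le> e" using \<open>0 < e\<close> \<open>B \<ge> 0\<close> by (simp add: field_simps)
      finally show "\<bar>LINT t|\<mu>. f t * g t\<bar> \<le> 0 + e" by simp
    qed
    then show ?thesis by simp
  qed
  have "(\<lambda>t. sgn (f t)) measurable_on open_ivl"
    by (subst measurable_on_iff_borel_measurable) auto
  then obtain N g where N: "negligible N" and g: "\<And>n. continuous_on UNIV (g n)"
      and lim: "\<And>t. t \<notin> N \<Longrightarrow> (\<lambda>n. g n t) \<longlonglongrightarrow> (if t \<in> open_ivl then sgn (f t) else 0)"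
    unfolding measurable_on_def by blast
  \<comment> \<open>Truncation keeps the approximations of the sign function dominated.\<close>
  define h where "h = (\<lambda>n t. max (-1) (min 1 (g n t :: real)))"
  have h: "continuous_on UNIV (h n)" for n
    unfolding h_def by (intro continuous_intros g)
  have hm [measurable]: "h n \<in> borel_measurable \<mu>" for n
    by (intro measurable_\<mu>_continuous continuous_on_subset[OF h]) simp
  have h0: "(LINT t|\<mu>. f t * h n t) = 0" for n
    by (intro cont_zero continuous_on_subset[OF h]) simp
  have "(\<lambda>n. LINT t|\<mu>. f t * h n t) \<longlonglongrightarrow> (LINT t|\<mu>. f t * sgn (f t))"
  proof (rule integral_dominated_convergence)
    show "integrable \<mu> (\<lambda>t. \<bar>f t\<bar>)" using f by simp
    have "\<bar>f t * h n t\<bar> \<le> \<bar>f t\<bar>" for n t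
    proof -
      have "\<bar>h n t\<bar> \<le> 1" by (simp add: h_def)
      then show ?thesis by (simp add: abs_mult mult_left_le)
    qed
    then show "AE t in \<mu>. norm (f t * h n t) \<le> \<bar>f t\<bar>" for n by simp
    have "AE t in lebesgue. t \<notin> N"
      using N by (simp add: negligible_iff_null_sets AE_not_in)
    then have AE_N: "AE t in \<mu>. t \<notin> N"
      by (subst AE_restrict_space_iff) (auto elim: eventually_mono)
    have pointwise: "(\<lambda>n. f t * h n t) \<longlonglongrightarrow> f t * sgn (f t)" if "t \<notin> N" "t \<in> open_ivl" for t
    proof -
      have "(\<lambda>n. h n t) \<longlonglongrightarrow> max (-1) (min 1 (sgn (f t)))"
        unfolding h_def using lim[OF that(1)] that(2) by (intro tendsto_intros) simp
      also have "max (-1) (min 1 (sgn (f t))) = sgn (f t)" by (auto simp: sgn_if)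
      finally show ?thesis by (intro tendsto_intros)
    qed
    show "AE t in \<mu>. (\<lambda>n. f t * h n t) \<longlonglongrightarrow> f t * sgn (f t)"
      using AE_N AE_space[of \<mu>] by eventually_elim (simp add: pointwise)
  qed (auto simp: mult.commute)
  then have "(LINT t|\<mu>. \<bar>f t\<bar>) = 0"
    by (simp add: h0 LIMSEQ_const_iff abs_sgn mult.commute)
  then have "AE t in \<mu>. \<bar>f t\<bar> = 0"
    using f by (subst (asm) integral_nonneg_eq_0_iff_AE) auto
  then show ?thesis by simp
qed

section \<open>Orthonormality of the associated Legendre functions\<close>

text \<open>
  The operator \<open>D\<close> is antisymmetric for the weight \<open>(1 - t\<^sup>2) ^ (m - 1)\<close>: the sum of the two integrands
  is the derivative of \<open>(1 - t\<^sup>2) ^ m p q\<close>, and for \<open>m \<ge> 1\<close> that polynomial vanishes at the end points.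
\<close>

lemma integral_ang_deriv:
  assumes "1 \<le> m"
  shows "(LINT t|\<mu>. poly (one_minus_sq ^ (m - 1) * (ang_deriv m p * q)) t)
           = - (LINT t|\<mu>. poly (one_minus_sq ^ (m - 1) * (p * ang_deriv m q)) t)"
proof -
  obtain l where m: "m = Suc l" using assms by (cases m) auto
  have "poly (one_minus_sq ^ (m - 1) * (ang_deriv m p * q)) t + poly (one_minus_sq ^ (m - 1) * (p * ang_deriv m q)) t
          = poly (pderiv (one_minus_sq ^ m * (p * q))) t" for t
    unfolding m pderiv_mult pderiv_power_Suc
    by (simp add: ang_deriv_def) (simp add: algebra_simps)
  then have "(LINT t|\<mu>. poly (one_minus_sq ^ (m - 1) * (ang_deriv m p * q)) t)
           + (LINT t|\<mu>. poly (one_minus_sq ^ (m - 1) * (p * ang_deriv m q)) t)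
         = integral\<^sup>L \<mu> (poly (pderiv (one_minus_sq ^ m * (p * q))))"
    by (subst Bochner_Integration.integral_add[symmetric]) (auto simp: integrable_poly simp del: poly_mult)
  also have "\<dots> = 0"
    unfolding integral_pderiv by (simp add: m)
  finally show ?thesis by simp
qed

text \<open>
  Integrating the derivative of \<open>t (1 - t\<^sup>2) ^ (n + 1)\<close> gives the recursion
  \<open>(2 n + 3) I (n + 1) = (2 n + 2) I n\<close>.
\<close>

lemma integral_one_minus_sq_power:
  "(LINT t|\<mu>. poly (one_minus_sq ^ n) t) = 2 * (2 ^ n * fact n)\<^sup>2 / fact (2 * n + 1)"
proof (induction n)
  case 0
  have "one_minus_sq ^ 0 = pderiv [:0, 1:]" by (simp add: pderiv_pCons one_pCons)
  then show ?case by (simp only: integral_pderiv) simp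
next
  case (Suc n)
  let ?I = "\<lambda>n. LINT t|\<mu>. poly (one_minus_sq ^ n) t"
  have "poly (pderiv ([:0, 1:] * one_minus_sq ^ Suc n)) t
          = (2 * real n + 3) * poly (one_minus_sq ^ Suc n) t - (2 * real n + 2) * poly (one_minus_sq ^ n) t" for t
    unfolding pderiv_mult pderiv_power_Suc
    by (simp add: pderiv_pCons) (simp add: algebra_simps power2_eq_square)
  then have "integral\<^sup>L \<mu> (poly (pderiv ([:0, 1:] * one_minus_sq ^ Suc n)))
               = (LINT t|\<mu>. (2 * real n + 3) * poly (one_minus_sq ^ Suc n) t - (2 * real n + 2) * poly (one_minus_sq ^ n) t)"
    by presburger
  also have "\<dots> = (2 * real n + 3) * ?I (Suc n) - (2 * real n + 2) * ?I n"
    by (simp only: Bochner_Integration.integral_diff integrable_mult_right integrable_poly integral_mult_right_zero)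
  finally have "(2 * real n + 3) * ?I (Suc n) = (2 * real n + 2) * ?I n"
    unfolding integral_pderiv by simp
  then have "?I (Suc n) = (2 * real n + 2) / (2 * real n + 3) * ?I n"
    by (simp add: field_simps)
  also have "\<dots> = 2 * (2 ^ Suc n * fact (Suc n))\<^sup>2 / fact (2 * Suc n + 1)"
  proof -
    have f: "fact (2 * Suc n + 1) = (2 * real n + 3) * ((2 * real n + 2) * fact (2 * n + 1))"
      by (simp add: algebra_simps)
    show ?thesis
      unfolding Suc.IH f by (simp add: divide_simps power2_eq_square) (simp add: algebra_simps)
  qed
  finally show ?case .
qed

text \<open>
  Downward induction from \<open>m = n\<close>, where the \<open>m\<close>-th derivative is constant. Integrating the derivative of
  \<open>(1 - t\<^sup>2) ^ (m + 1)\<close> times the \<open>m\<close>-th and the \<open>m + 1\<close>-st derivative of \<open>P\<^sub>n\<close> and using Legendre's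
  equation shows that consecutive norms differ by the factor \<open>(n - m) (n + m + 1)\<close>.
\<close>

lemma Legendre_derivative_norm:
  assumes "m \<le> n"
  defines "r \<equiv> \<lambda>j. (pderiv ^^ j) (legendre_poly n)"
  shows "(LINT t|\<mu>. poly (one_minus_sq ^ m * (r m * r m)) t)
           = 2 / (2 * real n + 1) * (fact (n + m) / fact (n - m))"
  using assms(1)
proof (induction m rule: inc_induct)
  case base
  have "degree (r n) = 0"
    by (simp add: r_def degree_higher_pderiv degree_legendre_poly)
  then obtain c where "r n = [:c:]" by (rule degree_eq_zeroE)
  then have rn: "poly (r n) t = coeff (r n) 0" for t by simp
  have "coeff (r n) 0 = pochhammer 1 n * coeff (legendre_poly n) n"
    by (simp add: r_def coeff_higher_pderiv)
  also have "coeff (legendre_poly n) n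
               = (-1) ^ n / (2 ^ n * fact n) * (pochhammer (real n + 1) n * (-1) ^ n)"
    using coeff_one_minus_sq_power[of n]
    by (simp add: legendre_poly_def coeff_higher_pderiv mult_2[symmetric] add.commute)
  also have "pochhammer 1 n * \<dots> = (pochhammer 1 n * pochhammer (1 + real n) n) / (2 ^ n * fact n)"
    by (simp add: add.commute flip: power_add mult_2)
  also have "pochhammer 1 n * pochhammer (1 + real n) n = fact (2 * n)"
    using pochhammer_product'[of "1 :: real" n n] by (simp only: pochhammer_fact mult_2)
  finally have c: "coeff (r n) 0 = fact (2 * n) / (2 ^ n * fact n)" .
  have "(LINT t|\<mu>. poly (one_minus_sq ^ n * (r n * r n)) t)
          = (LINT t|\<mu>. (coeff (r n) 0)\<^sup>2 * poly (one_minus_sq ^ n) t)"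
    by (intro Bochner_Integration.integral_cong) (simp_all add: rn power2_eq_square)
  also have "\<dots> = (coeff (r n) 0)\<^sup>2 * (2 * (2 ^ n * fact n)\<^sup>2 / fact (2 * n + 1))"
    by (simp only: integral_mult_right_zero integral_one_minus_sq_power)
  also have "\<dots> = 2 * (fact (2 * n))\<^sup>2 / fact (2 * n + 1)"
    by (simp add: c power_divide)
  also have "fact (2 * n + 1) = (2 * real n + 1) * fact (2 * n)"
    by (simp add: algebra_simps)
  also have "2 * (fact (2 * n))\<^sup>2 / ((2 * real n + 1) * fact (2 * n))
      = 2 / (2 * real n + 1) * (fact (n + n) / fact (n - n))"
    unfolding mult_2[symmetric] by (simp add: power2_eq_square)
  finally show ?case .
next
  case (step m)
  have ode: "(1 - t\<^sup>2) * poly (r (Suc (Suc m))) t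
      = 2 * (real m + 1) * (t * poly (r (Suc m)) t) - (real n - real m) * (real n + real m + 1) * poly (r m) t" for t
    using arg_cong[OF Legendre_ode[of m n], of "\<lambda>p. poly p t"] by (simp add: r_def algebra_simps)
  have "poly (pderiv (one_minus_sq ^ Suc m * (r m * r (Suc m)))) t
     = poly (one_minus_sq ^ Suc m * (r (Suc m) * r (Suc m))) t
       - (real n - real m) * (real n + real m + 1) * poly (one_minus_sq ^ m * (r m * r m)) t" for t
  proof -
    have "poly (pderiv (one_minus_sq ^ Suc m * (r m * r (Suc m)))) t =
      (1 - t\<^sup>2) ^ m * poly (r m) t * ((1 - t\<^sup>2) * poly (r (Suc (Suc m))) t)
      + (1 - t\<^sup>2) ^ m * (1 - t\<^sup>2) * (poly (r (Suc m)) t * poly (r (Suc m)) t)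
      - 2 * (real m + 1) * t * (1 - t\<^sup>2) ^ m * (poly (r m) t * poly (r (Suc m)) t)"
      unfolding pderiv_mult pderiv_power_Suc
      by (simp add: r_def) (simp add: algebra_simps)
    then show ?thesis
      unfolding ode by (simp add: algebra_simps)
  qed
  then have "integral\<^sup>L \<mu> (poly (pderiv (one_minus_sq ^ Suc m * (r m * r (Suc m)))))
     = (LINT t|\<mu>. poly (one_minus_sq ^ Suc m * (r (Suc m) * r (Suc m))) t
       - (real n - real m) * (real n + real m + 1) * poly (one_minus_sq ^ m * (r m * r m)) t)"
    by presburger
  also have "\<dots> = (LINT t|\<mu>. poly (one_minus_sq ^ Suc m * (r (Suc m) * r (Suc m))) t)
      - (real n - real m) * (real n + real m + 1) * (LINT t|\<mu>. poly (one_minus_sq ^ m * (r m * r m)) t)"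
    by (simp only: Bochner_Integration.integral_diff integrable_mult_right integrable_poly integral_mult_right_zero)
  finally have 1: "(real n - real m) * (real n + real m + 1) * (LINT t|\<mu>. poly (one_minus_sq ^ m * (r m * r m)) t)
      = 2 / (2 * real n + 1) * (fact (n + Suc m) / fact (n - Suc m))"
    unfolding integral_pderiv step.IH by simp
  have 2: "fact (n + Suc m) = (real n + real m + 1) * fact (n + m)" by simp
  have "n - m = Suc (n - Suc m)" using step.hyps by simp
  then have 3: "fact (n - m) = (real n - real m) * fact (n - Suc m)"
    using step.hyps by (simp only: fact_Suc) (simp add: of_nat_diff algebra_simps)
  \<comment> \<open>The factors relating consecutive norms are non-zero because \<open>m < n\<close>, so they cancel.\<close>
  define a b where "a = real n - real m" and "b = real n + real m + 1"
  have "a \<noteq> 0" "b \<noteq> 0" using step.hyps by (auto simp: a_def b_def)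
  then have "x = c * (F / (a * G))" if "a * b * x = c * ((b * F) / G)" for x c F G
    using that by (cases "G = 0") (simp_all add: field_simps)
  then show ?case
    using 1 unfolding 2 3 a_def b_def .
qed

text \<open>
  The weak form of the eigenvalue equation, with \<open>D\<close> moved from one factor to the other.
\<close>

lemma assoc_poly_energy:
  assumes "1 \<le> m"
  shows "(LINT t|\<mu>. poly (one_minus_sq ^ (m - 1) * (ang_deriv m (assoc_poly k m) * ang_deriv m (assoc_poly n m))) t)
           + (real m)\<^sup>2 * (LINT t|\<mu>. poly (one_minus_sq ^ (m - 1) * (assoc_poly k m * assoc_poly n m)) t)
         = real n * (real n + 1) * (LINT t|\<mu>. poly (one_minus_sq ^ m * (assoc_poly k m * assoc_poly n m)) t)"
proof -
  let ?p = "assoc_poly k m" and ?q = "assoc_poly n m"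
  obtain l where m: "m = Suc l" using assms by (cases m) auto
  have "(LINT t|\<mu>. poly (one_minus_sq ^ (m - 1) * (?p * ang_deriv m (ang_deriv m ?q))) t)
     = (LINT t|\<mu>. (real m)\<^sup>2 * poly (one_minus_sq ^ (m - 1) * (?p * ?q)) t
         - real n * (real n + 1) * poly (one_minus_sq ^ m * (?p * ?q)) t)"
    by (intro Bochner_Integration.integral_cong refl)
       (simp add: ang_deriv_ang_deriv_assoc_poly m, simp add: algebra_simps)
  also have "\<dots> = (real m)\<^sup>2 * (LINT t|\<mu>. poly (one_minus_sq ^ (m - 1) * (?p * ?q)) t)
      - real n * (real n + 1) * (LINT t|\<mu>. poly (one_minus_sq ^ m * (?p * ?q)) t)"
    by (simp only: Bochner_Integration.integral_diff integrable_mult_right integrable_poly integral_mult_right_zero)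
  finally show ?thesis
    using integral_ang_deriv[OF assms, of ?p "ang_deriv m ?q"] by linarith
qed

text \<open>
  The left-hand side of the energy identity is symmetric in \<open>k\<close> and \<open>n\<close>, so functions for different
  eigenvalues are orthogonal.
\<close>

lemma assoc_poly_orthonormal:
  assumes "1 \<le> m" "m \<le> n"
  shows "(LINT t|\<mu>. poly (one_minus_sq ^ m * (assoc_poly k m * assoc_poly n m)) t) = (if k = n then 1 else 0)"
proof (cases "k = n")
  case True
  define r where "r = (pderiv ^^ m) (legendre_poly n)"
  have "(LINT t|\<mu>. poly (one_minus_sq ^ m * (assoc_poly n m * assoc_poly n m)) t)
      = (LINT t|\<mu>. (assoc_c n m)\<^sup>2 * poly (one_minus_sq ^ m * (r * r)) t)"
    by (intro Bochner_Integration.integral_cong refl) (simp add: assoc_poly_def r_def power2_eq_square)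
  also have "\<dots> = (assoc_c n m)\<^sup>2 * (2 / (2 * real n + 1) * (fact (n + m) / fact (n - m)))"
    unfolding r_def by (simp only: integral_mult_right_zero Legendre_derivative_norm[OF assms(2)])
  also have "(assoc_c n m)\<^sup>2 = (2 * real n + 1) / 2 * (fact (n - m) / fact (n + m))"
    unfolding assoc_c_def by (subst real_sqrt_pow2) simp_all
  also have "(2 * real n + 1) / 2 * (fact (n - m) / fact (n + m))
      * (2 / (2 * real n + 1) * (fact (n + m) / fact (n - m))) = 1"
  proof -
    have "x / 2 * (F / G) * (2 / x * (G / F)) = 1" if "x \<noteq> 0" "F \<noteq> 0" "G \<noteq> 0" for x F G :: real
      using that by (simp add: divide_simps)
    moreover have "2 * real n + 1 \<noteq> 0" by linarith
    ultimately show ?thesis by (metis fact_nonzero)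
  qed
  finally show ?thesis using True by simp
next
  case False
  let ?I = "\<lambda>k n. LINT t|\<mu>. poly (one_minus_sq ^ m * (assoc_poly k m * assoc_poly n m)) t"
  have "real k * (real k + 1) * ?I n k = real n * (real n + 1) * ?I k n"
    using assoc_poly_energy[OF assms(1), of k n] assoc_poly_energy[OF assms(1), of n k]
    unfolding mult.commute[of "assoc_poly n m" "assoc_poly k m"]
      mult.commute[of "ang_deriv m (assoc_poly n m)" "ang_deriv m (assoc_poly k m)"]
    by linarith
  moreover have "?I n k = ?I k n"
    unfolding mult.commute[of "assoc_poly n m" "assoc_poly k m"] by (rule refl)
  ultimately have "(real k * (real k + 1) - real n * (real n + 1)) * ?I k n = 0"
    by (simp only: left_diff_distrib)
  moreover have "real k * (real k + 1) - real n * (real n + 1) = (real k - real n) * (real k + real n + 1)"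
    by (simp add: algebra_simps)
  moreover have "real k + real n + 1 \<noteq> 0" "real k - real n \<noteq> 0" using False by linarith+
  ultimately have "?I k n = 0" by (simp only: mult_eq_0_iff simp_thms)
  with False show ?thesis by (simp only: if_False)
qed

lemma omega_pos: "t \<in> open_ivl \<Longrightarrow> 0 < \<omega> t"
  using abs_square_less_1[of t] by (simp add: \<omega>_def abs_less_iff)

lemma omega_square: "t \<in> open_ivl \<Longrightarrow> \<omega> t * \<omega> t = 1 - t\<^sup>2"
  using abs_square_less_1[of t] by (simp add: \<omega>_def abs_less_iff)

lemma omega_le_1: "\<omega> t \<le> 1"
  by (simp add: \<omega>_def)

lemma continuous_on_omega [continuous_intros]: "continuous_on S \<omega>"
  unfolding \<omega>_def by (intro continuous_intros)

lemma L2_omega_poly: "(\<lambda>t. \<omega> t ^ a * poly p t) \<in> L2"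
  by (intro L2_continuous continuous_intros)

lemma L2_inner_omega_poly:
  "L2_inner (\<lambda>t. \<omega> t ^ a * poly p t) (\<lambda>t. \<omega> t ^ a * poly q t)
     = (LINT t|\<mu>. poly (one_minus_sq ^ a * (p * q)) t)"
  unfolding L2_inner_def
proof (intro Bochner_Integration.integral_cong refl)
  fix t assume "t \<in> space \<mu>"
  then have "\<omega> t ^ a * \<omega> t ^ a = (1 - t\<^sup>2) ^ a"
    by (simp add: power_mult_distrib[symmetric] omega_square)
  then have "poly (one_minus_sq ^ a * (p * q)) t = \<omega> t ^ a * \<omega> t ^ a * (poly p t * poly q t)"
    by (simp only: poly_mult poly_power poly_one_minus_sq)
  then show "\<omega> t ^ a * poly p t * (\<omega> t ^ a * poly q t) = poly (one_minus_sq ^ a * (p * q)) t"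
    by (simp only: mult_ac)
qed

text \<open>
  For \<open>m \<ge> 1\<close> the following two functions are \<open>\<omega> Q'\<close> and \<open>Q / \<omega>\<close>. In this form they are defined and
  continuous on all of \<open>[-1, 1]\<close>.
\<close>

definition assoc_dQ :: "nat \<Rightarrow> nat \<Rightarrow> real \<Rightarrow> real" where
  "assoc_dQ n m t = \<omega> t ^ (m - 1) * poly (ang_deriv m (assoc_poly n m)) t"

definition assoc_Qw :: "nat \<Rightarrow> nat \<Rightarrow> real \<Rightarrow> real" where
  "assoc_Qw n m t = \<omega> t ^ (m - 1) * poly (assoc_poly n m) t"

lemma L2_assoc: "assoc_Q n m \<in> L2" "assoc_dQ n m \<in> L2" "assoc_Qw n m \<in> L2"
  unfolding assoc_Q_eq_poly[abs_def] assoc_dQ_def[abs_def] assoc_Qw_def[abs_def] by (rule L2_omega_poly)+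

lemma assoc_Q_eq_omega_Qw: "1 \<le> m \<Longrightarrow> assoc_Q n m t = \<omega> t * assoc_Qw n m t"
  by (cases m) (simp_all add: assoc_Q_eq_poly assoc_Qw_def)

lemma assoc_Q_orthonormal:
  assumes "1 \<le> m" "m \<le> n"
  shows "L2_inner (assoc_Q k m) (assoc_Q n m) = (if k = n then 1 else 0)"
proof -
  have "assoc_Q j m = (\<lambda>t. \<omega> t ^ m * poly (assoc_poly j m) t)" for j
    by (rule ext) (rule assoc_Q_eq_poly)
  then show ?thesis
    by (simp only: L2_inner_omega_poly assoc_poly_orthonormal[OF assms])
qed

lemma assoc_Q_energy:
  assumes "1 \<le> m" "m \<le> n"
  shows "L2_inner (assoc_dQ k m) (assoc_dQ n m) + (real m)\<^sup>2 * L2_inner (assoc_Qw k m) (assoc_Qw n m)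
           = (if k = n then real n * (real n + 1) else 0)"
  unfolding assoc_dQ_def[abs_def] assoc_Qw_def[abs_def] L2_inner_omega_poly
    assoc_poly_energy[OF assms(1)] assoc_poly_orthonormal[OF assms] by simp

section \<open>Completeness of the associated Legendre functions\<close>

text \<open>
  The polynomials \<open>assoc_poly n m\<close>, for \<open>n \<ge> m\<close>, have all degrees \<open>n - m \<ge> 0\<close> and therefore span all
  polynomials.
\<close>

lemma integral_poly_zero_if_orthogonal:
  assumes "\<And>n. m \<le> n \<Longrightarrow> (LINT t|\<mu>. f t * poly (assoc_poly n m) t) = 0"
    and f: "\<And>p :: real poly. integrable \<mu> (\<lambda>t. f t * poly p t)"
  shows "(LINT t|\<mu>. f t * poly p t) = 0"
proof (induction "degree p" arbitrary: p rule: less_induct)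
  case less
  \<comment> \<open>The function of degree index \<open>degree p + m\<close> supplies a polynomial of the same degree as \<open>p\<close>,
    so a multiple of it cancels the leading term.\<close>
  define q where "q = assoc_poly (degree p + m) m"
  have q: "degree q = degree p" "q \<noteq> 0" "(LINT t|\<mu>. f t * poly q t) = 0"
  proof -
    have "m \<le> degree p + m" by simp
    from degree_assoc_poly[OF this] assms(1)[OF this]
    show "degree q = degree p" "q \<noteq> 0" "(LINT t|\<mu>. f t * poly q t) = 0"
      by (simp_all add: q_def)
  qed
  define c where "c = lead_coeff p / lead_coeff q"
  define s where "s = p - smult c q"
  have split: "(LINT t|\<mu>. f t * poly p t) = (LINT t|\<mu>. f t * poly s t) + c * (LINT t|\<mu>. f t * poly q t)"
  proof -
    have "(LINT t|\<mu>. f t * poly p t) = (LINT t|\<mu>. f t * poly s t + c * (f t * poly q t))"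
      by (intro Bochner_Integration.integral_cong refl) (simp add: s_def algebra_simps)
    also have "\<dots> = (LINT t|\<mu>. f t * poly s t) + (LINT t|\<mu>. c * (f t * poly q t))"
      by (intro Bochner_Integration.integral_add integrable_mult_right f)
    finally show ?thesis by (simp only: integral_mult_right_zero)
  qed
  have "degree (smult c q) \<le> degree p"
    using degree_smult_le[of c q] unfolding q(1) .
  then have "degree s \<le> degree p"
    unfolding s_def by (intro degree_diff_le order_refl)
  moreover have "coeff s (degree p) = lead_coeff p - c * lead_coeff q"
    by (simp only: s_def coeff_diff coeff_smult q(1))
  then have "coeff s (degree p) = 0"
  proof -
    have "lead_coeff q \<noteq> 0" using q(2) by (simp only: leading_coeff_0_iff not_False_eq_True)
    then have "c * lead_coeff q = lead_coeff p" by (simp add: c_def)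
    with \<open>coeff s (degree p) = lead_coeff p - c * lead_coeff q\<close> show ?thesis by simp
  qed
  ultimately have "s = 0 \<or> degree s < degree p"
    by (metis leading_coeff_0_iff le_neq_implies_less)
  then have "(LINT t|\<mu>. f t * poly s t) = 0"
  proof
    assume "degree s < degree p"
    then show ?thesis by (rule less)
  qed simp
  with split q(3) show ?case by (simp only: mult_zero_right add_0)
qed

text \<open>
  Orthogonality to all \<open>Q\<^sub>n\<close> means that \<open>\<omega>\<^sup>m u\<close> has vanishing moments.
\<close>

lemma assoc_Q_complete:
  assumes u: "u \<in> L2" and orth: "\<And>n. m \<le> n \<Longrightarrow> L2_inner u (assoc_Q n m) = 0"
  shows "AE t in \<mu>. u t = 0"
proof -
  have int: "integrable \<mu> (\<lambda>t. u t * \<omega> t ^ m * poly p t)" for p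
    using L2_mult_integrable[OF u L2_omega_poly[of m p]] by (simp add: mult_ac)
  have zero: "(LINT t|\<mu>. u t * \<omega> t ^ m * poly p t) = 0" for p
    by (rule integral_poly_zero_if_orthogonal[where m = m, OF _ int])
       (use orth in \<open>simp add: L2_inner_def assoc_Q_eq_poly mult_ac\<close>)
  have "AE t in \<mu>. u t * \<omega> t ^ m = 0"
  proof (rule AE_zero_if_moments_zero)
    show "integrable \<mu> (\<lambda>t. u t * \<omega> t ^ m)" using int[of 1] by simp
    show "(LINT t|\<mu>. u t * \<omega> t ^ m * t ^ k) = 0" for k
      using zero[of "monom 1 k"] by (simp add: poly_monom)
  qed
  then show ?thesis
    using AE_space[of \<mu>] by eventually_elim (use omega_pos in force)
qed

section \<open>Smooth cut-off functions\<close>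

text \<open>
  Factors that may stand in front of the cut-off \<open>exp (- d / (1 - t\<^sup>2 - d))\<close>. The class contains
  \<open>\<omega>\<^sup>m q\<close>, is closed under differentiation on \<open>1 - t\<^sup>2 > d\<close>, and its members grow at most like a power
  of \<open>1 / (1 - t\<^sup>2 - d)\<close>, which the exponential absorbs. Together these facts give smoothness of the product.
\<close>

inductive cutoff_amplitude :: "real \<Rightarrow> (real \<Rightarrow> real) \<Rightarrow> bool" for d :: real where
  amp_poly: "cutoff_amplitude d (poly p)"
| amp_omega: "cutoff_amplitude d \<omega>"
| amp_inverse_omega: "cutoff_amplitude d (\<lambda>t. inverse (\<omega> t))"
| amp_inverse: "cutoff_amplitude d (\<lambda>t. inverse (1 - t\<^sup>2 - d))"
| amp_add: "cutoff_amplitude d g \<Longrightarrow> cutoff_amplitude d h \<Longrightarrow> cutoff_amplitude d (\<lambda>t. g t + h t)"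
| amp_mult: "cutoff_amplitude d g \<Longrightarrow> cutoff_amplitude d h \<Longrightarrow> cutoff_amplitude d (\<lambda>t. g t * h t)"

definition cutoff :: "real \<Rightarrow> (real \<Rightarrow> real) \<Rightarrow> real \<Rightarrow> real" where
  "cutoff d g t = (if d < 1 - t\<^sup>2 then g t * exp (- (d / (1 - t\<^sup>2 - d))) else 0)"

lemma square_less_1_iff: "t\<^sup>2 < 1 \<longleftrightarrow> t \<in> open_ivl" for t :: real
  using abs_square_less_1[of t] by auto

lemma DERIV_omega:
  assumes "t \<in> open_ivl"
  shows "(\<omega> has_real_derivative - t * inverse (\<omega> t)) (at t)"
proof -
  have "0 < 1 - t\<^sup>2" using assms square_less_1_iff[of t] by simp
  have "((\<lambda>t. 1 - t\<^sup>2) has_real_derivative - 2 * t) (at t)"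
    by (auto intro!: derivative_eq_intros)
  from DERIV_chain2[OF DERIV_real_sqrt[OF \<open>0 < 1 - t\<^sup>2\<close>] this]
  show ?thesis
    by (simp add: \<omega>_def[abs_def] mult.commute)
qed

lemma amp_power: "cutoff_amplitude d g \<Longrightarrow> cutoff_amplitude d (\<lambda>t. g t ^ k)"
proof (induction k)
  case 0
  show ?case using amp_poly[of d 1] by (simp add: poly_1[abs_def])
next
  case (Suc k)
  then show ?case using amp_mult[of d g "\<lambda>t. g t ^ k"] by simp
qed

lemma cutoff_amplitude_derivative:
  assumes "cutoff_amplitude d g" "0 < d"
  shows "\<exists>g'. cutoff_amplitude d g' \<and> (\<forall>t. d < 1 - t\<^sup>2 \<longrightarrow> (g has_real_derivative g' t) (at t))"
  using assms(1)
proof induction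
  case (amp_poly p)
  show ?case
    by (intro exI[of _ "poly (pderiv p)"]) (simp add: cutoff_amplitude.amp_poly)
next
  case amp_omega
  have "cutoff_amplitude d (\<lambda>t. poly [:0, -1:] t * inverse (\<omega> t))"
    by (intro cutoff_amplitude.intros)
  moreover have "(\<omega> has_real_derivative poly [:0, -1:] t * inverse (\<omega> t)) (at t)" if "d < 1 - t\<^sup>2" for t
    using DERIV_omega[of t] that \<open>0 < d\<close> square_less_1_iff[of t] by simp
  ultimately show ?case by blast
next
  case amp_inverse_omega
  have "cutoff_amplitude d (\<lambda>t. poly [:0, 1:] t * inverse (\<omega> t) ^ 3)"
    by (intro cutoff_amplitude.intros amp_power)
  moreover have "((\<lambda>t. inverse (\<omega> t)) has_real_derivative poly [:0, 1:] t * inverse (\<omega> t) ^ 3) (at t)"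
    if "d < 1 - t\<^sup>2" for t
  proof -
    have t: "t \<in> open_ivl" using that \<open>0 < d\<close> square_less_1_iff[of t] by simp
    have "((\<lambda>t. inverse (\<omega> t)) has_real_derivative - (inverse (\<omega> t) * (- t * inverse (\<omega> t)) * inverse (\<omega> t))) (at t)"
      using omega_pos[OF t] by (intro DERIV_inverse' DERIV_omega[OF t]) simp
    then show ?thesis by (simp add: power3_eq_cube mult_ac)
  qed
  ultimately show ?case by blast
next
  case amp_inverse
  have "cutoff_amplitude d (\<lambda>t. poly [:0, 2:] t * inverse (1 - t\<^sup>2 - d) ^ 2)"
    by (intro cutoff_amplitude.intros amp_power)
  moreover have "((\<lambda>t. inverse (1 - t\<^sup>2 - d)) has_real_derivative poly [:0, 2:] t * inverse (1 - t\<^sup>2 - d) ^ 2) (at t)"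
    if "d < 1 - t\<^sup>2" for t
  proof -
    have "((\<lambda>t. 1 - t\<^sup>2 - d) has_real_derivative - 2 * t) (at t)"
      by (auto intro!: derivative_eq_intros)
    then have "((\<lambda>t. inverse (1 - t\<^sup>2 - d)) has_real_derivative
        - (inverse (1 - t\<^sup>2 - d) * (- 2 * t) * inverse (1 - t\<^sup>2 - d))) (at t)"
      by (rule DERIV_inverse') (use that in simp)
    then show ?thesis by (simp add: power2_eq_square mult_ac)
  qed
  ultimately show ?case by blast
next
  case (amp_add g h)
  then obtain g' h' where "cutoff_amplitude d g'" "\<And>t. d < 1 - t\<^sup>2 \<Longrightarrow> (g has_real_derivative g' t) (at t)"
     "cutoff_amplitude d h'" "\<And>t. d < 1 - t\<^sup>2 \<Longrightarrow> (h has_real_derivative h' t) (at t)" by blast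
  then show ?case
    by (intro exI[of _ "\<lambda>t. g' t + h' t"]) (auto intro: cutoff_amplitude.intros DERIV_add)
next
  case (amp_mult g h)
  then obtain g' h' where "cutoff_amplitude d g'" "\<And>t. d < 1 - t\<^sup>2 \<Longrightarrow> (g has_real_derivative g' t) (at t)"
     "cutoff_amplitude d h'" "\<And>t. d < 1 - t\<^sup>2 \<Longrightarrow> (h has_real_derivative h' t) (at t)" by blast
  with amp_mult.hyps show ?case
    by (intro exI[of _ "\<lambda>t. g' t * h t + h' t * g t"]) (auto intro!: cutoff_amplitude.intros DERIV_mult)
qed

lemma cutoff_amplitude_growth:
  assumes "cutoff_amplitude d g" "0 < d"
  shows "\<exists>C l. 0 \<le> C \<and> (\<forall>t. d < 1 - t\<^sup>2 \<longrightarrow> \<bar>g t\<bar> \<le> C * inverse (1 - t\<^sup>2 - d) ^ l)"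
  using assms(1)
proof induction
  case (amp_poly p)
  obtain C where C: "\<And>t. t \<in> {-1..1} \<Longrightarrow> \<bar>poly p t\<bar> \<le> C"
    by (rule continuous_on_ivl_bounded[of "poly p"]) (auto intro: continuous_intros)
  have "\<bar>poly p t\<bar> \<le> C" if "d < 1 - t\<^sup>2" for t
    using C[of t] that \<open>0 < d\<close> square_less_1_iff[of t] by auto
  then show ?case
    by (intro exI[of _ "\<bar>C\<bar>"] exI[of _ 0]) fastforce
next
  case amp_omega
  have "\<bar>\<omega> t\<bar> \<le> 1" if "d < 1 - t\<^sup>2" for t
    using omega_le_1[of t] omega_pos[of t] square_less_1_iff[of t] that \<open>0 < d\<close> by simp
  then show ?case by (intro exI[of _ 1] exI[of _ 0]) simp
next
  case amp_inverse_omega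
  have "\<bar>inverse (\<omega> t)\<bar> \<le> 1 * inverse (1 - t\<^sup>2 - d) ^ 1" if "d < 1 - t\<^sup>2" for t
  proof -
    have t: "t \<in> open_ivl" using that \<open>0 < d\<close> square_less_1_iff[of t] by simp
    have "\<omega> t * \<omega> t \<le> \<omega> t * 1"
      using omega_pos[OF t] omega_le_1[of t] by (intro mult_left_mono) auto
    then have "1 - t\<^sup>2 - d \<le> \<omega> t"
      using omega_square[OF t] \<open>0 < d\<close> by simp
    then show ?thesis
      using that omega_pos[OF t] by (simp add: le_imp_inverse_le)
  qed
  then show ?case by (intro exI[of _ 1] exI[of _ 1]) simp
next
  case amp_inverse
  show ?case by (intro exI[of _ 1] exI[of _ 1]) simp
next
  case (amp_add g h)
  then obtain C l C' l' where C: "0 \<le> C" "0 \<le> C'"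
     and g: "\<And>t. d < 1 - t\<^sup>2 \<Longrightarrow> \<bar>g t\<bar> \<le> C * inverse (1 - t\<^sup>2 - d) ^ l"
     and h: "\<And>t. d < 1 - t\<^sup>2 \<Longrightarrow> \<bar>h t\<bar> \<le> C' * inverse (1 - t\<^sup>2 - d) ^ l'"
    by blast
  have "\<bar>g t + h t\<bar> \<le> (C + C') * inverse (1 - t\<^sup>2 - d) ^ (l + l')" if "d < 1 - t\<^sup>2" for t
  proof -
    define x where "x = inverse (1 - t\<^sup>2 - d)"
    have "1 - t\<^sup>2 - d \<le> 1" using \<open>0 < d\<close> by (smt (verit) zero_le_power2)
    then have "1 \<le> x" using that by (simp add: x_def one_le_inverse_iff)
    then have "x ^ l \<le> x ^ (l + l')" "x ^ l' \<le> x ^ (l + l')"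
      by (auto intro: power_increasing)
    then have "C * x ^ l \<le> C * x ^ (l + l')" "C' * x ^ l' \<le> C' * x ^ (l + l')"
      using C by (auto intro: mult_left_mono)
    then show ?thesis
      using g[OF that] h[OF that] unfolding x_def[symmetric] by (simp add: distrib_right)
  qed
  then show ?case using C by (intro exI[of _ "C + C'"] exI[of _ "l + l'"]) simp
next
  case (amp_mult g h)
  then obtain C l C' l' where C: "0 \<le> C" "0 \<le> C'"
     and g: "\<And>t. d < 1 - t\<^sup>2 \<Longrightarrow> \<bar>g t\<bar> \<le> C * inverse (1 - t\<^sup>2 - d) ^ l"
     and h: "\<And>t. d < 1 - t\<^sup>2 \<Longrightarrow> \<bar>h t\<bar> \<le> C' * inverse (1 - t\<^sup>2 - d) ^ l'"
    by blast
  have "\<bar>g t * h t\<bar> \<le> (C * C') * inverse (1 - t\<^sup>2 - d) ^ (l + l')" if "d < 1 - t\<^sup>2" for t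
  proof -
    have "\<bar>g t\<bar> * \<bar>h t\<bar> \<le> (C * inverse (1 - t\<^sup>2 - d) ^ l) * (C' * inverse (1 - t\<^sup>2 - d) ^ l')"
      using that C by (intro mult_mono g h) auto
    then show ?thesis by (simp add: abs_mult power_add mult_ac)
  qed
  then show ?case using C by (intro exI[of _ "C * C'"] exI[of _ "l + l'"]) simp
qed

text \<open>
  The exponential beats every power of \<open>1 / (1 - t\<^sup>2 - d)\<close>; quadratic decay is what differentiability at
  the boundary of the support requires.
\<close>

lemma cutoff_flat:
  assumes "cutoff_amplitude d g" "0 < d"
  obtains K where "\<And>s. \<bar>cutoff d g s\<bar> \<le> K * (1 - s\<^sup>2 - d)\<^sup>2"
proof -
  obtain C l where C: "0 \<le> C" and g: "\<And>t. d < 1 - t\<^sup>2 \<Longrightarrow> \<bar>g t\<bar> \<le> C * inverse (1 - t\<^sup>2 - d) ^ l"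
    using cutoff_amplitude_growth[OF assms] by blast
  \<comment> \<open>Two powers beyond the growth order \<open>l\<close> leave a square.\<close>
  define n where "n = l + 2"
  define K where "K = C * (real n / d) ^ n"
  have "0 \<le> K" using C \<open>0 < d\<close> by (simp add: K_def)
  have "\<bar>cutoff d g s\<bar> \<le> K * (1 - s\<^sup>2 - d)\<^sup>2" for s
  proof (cases "d < 1 - s\<^sup>2")
    case True
    define x where "x = 1 - s\<^sup>2 - d"
    have "0 < x" using True by (simp add: x_def)
    have "0 < n" by (simp add: n_def)
    \<comment> \<open>From \<open>y / n \<le> exp (y / n)\<close> one gets \<open>exp (- y) \<le> (n / y) ^ n\<close>.\<close>
    have "d / x / n \<le> exp (d / x / n)"
      using exp_ge_add_one_self[of "d / x / n"] by linarith
    then have "(d / x / n) ^ n \<le> exp (d / x / n) ^ n"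
      using \<open>0 < x\<close> \<open>0 < d\<close> by (intro power_mono) auto
    also have "\<dots> = exp (d / x)"
      using \<open>0 < n\<close> by (simp add: exp_of_nat_mult[symmetric])
    finally have "exp (- (d / x)) \<le> inverse ((d / x / n) ^ n)"
      using \<open>0 < x\<close> \<open>0 < d\<close> \<open>0 < n\<close> unfolding exp_minus by (intro le_imp_inverse_le) auto
    also have "\<dots> = (real n / d) ^ n * x ^ n"
      by (simp add: power_divide field_simps)
    finally have e: "exp (- (d / x)) \<le> (real n / d) ^ n * x ^ n" .
    have "\<bar>cutoff d g s\<bar> = \<bar>g s\<bar> * exp (- (d / x))"
      using True by (simp add: cutoff_def x_def abs_mult)
    also have "\<dots> \<le> (C * inverse x ^ l) * ((real n / d) ^ n * x ^ n)"
      using g[OF True] e C \<open>0 < x\<close> by (intro mult_mono) (auto simp: x_def)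
    also have "\<dots> = C * (real n / d) ^ n * (inverse x ^ l * x ^ n)"
      by (simp only: mult_ac)
    also have "inverse x ^ l * x ^ n = x\<^sup>2"
      using \<open>0 < x\<close> by (simp add: n_def power_add power_inverse power2_eq_square)
    also have "C * (real n / d) ^ n * x\<^sup>2 = K * x\<^sup>2"
      by (simp only: K_def)
    finally show ?thesis by (simp add: x_def)
  qed (use \<open>0 \<le> K\<close> in \<open>simp add: cutoff_def\<close>)
  then show thesis by (rule that)
qed

lemma DERIV_zero_if_quadratic:
  fixes f :: "real \<Rightarrow> real"
  assumes "\<And>s. \<bar>s - t\<bar> < 1 \<Longrightarrow> \<bar>f s\<bar> \<le> K * (s - t)\<^sup>2"
  shows "(f has_real_derivative 0) (at t)"
proof -
  have "f t = 0" using assms[of t] by simp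
  have "((\<lambda>h. f (t + h) / h) \<longlongrightarrow> 0) (at 0)"
  proof (rule Lim_null_comparison)
    have "\<forall>\<^sub>F h in at (0::real). \<bar>h\<bar> < 1"
      unfolding eventually_at by (intro exI[of _ 1]) (auto simp: dist_real_def)
    then show "\<forall>\<^sub>F h in at 0. norm (f (t + h) / h) \<le> K * \<bar>h\<bar>"
    proof eventually_elim
      case (elim h)
      then have "\<bar>f (t + h)\<bar> \<le> K * h\<^sup>2" using assms[of "t + h"] by simp
      then show ?case
        by (cases "h = 0") (auto simp: divide_le_eq power2_eq_square mult.assoc)
    qed
    show "((\<lambda>h. K * \<bar>h\<bar>) \<longlongrightarrow> 0) (at 0)"
      by (rule tendsto_eq_intros | simp)+
  qed
  then show ?thesis
    using \<open>f t = 0\<close> by (simp add: DERIV_def)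
qed

text \<open>
  The derivative is again a cut-off function, so that the statement can be iterated. At the points with
  \<open>1 - t\<^sup>2 = d\<close> both sides vanish, by the quadratic flatness above.
\<close>

lemma DERIV_cutoff:
  assumes g: "cutoff_amplitude d g" and "0 < d"
    and g': "\<And>t. d < 1 - t\<^sup>2 \<Longrightarrow> (g has_real_derivative g' t) (at t)"
  shows "(cutoff d g has_real_derivative cutoff d (\<lambda>t. g' t - 2 * d * t * g t * inverse (1 - t\<^sup>2 - d) ^ 2) t) (at t)"
proof (cases "1 - t\<^sup>2" d rule: linorder_cases)
  case greater
  define x where "x = (\<lambda>t. 1 - t\<^sup>2 - d)"
  have "0 < x t" using greater by (simp add: x_def)
  have dx: "(x has_real_derivative - 2 * t) (at t)"
    unfolding x_def by (auto intro!: derivative_eq_intros)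
  have "((\<lambda>t. exp (- (d / x t))) has_real_derivative exp (- (d / x t)) * (- 2 * d * t / (x t)\<^sup>2)) (at t)"
    using \<open>0 < x t\<close> by (auto intro!: derivative_eq_intros dx simp: power2_eq_square)
  then have "((\<lambda>t. g t * exp (- (d / x t))) has_real_derivative
      g' t * exp (- (d / x t)) + exp (- (d / x t)) * (- 2 * d * t / (x t)\<^sup>2) * g t) (at t)"
    by (intro DERIV_mult g' greater)
  moreover have "cutoff d (\<lambda>t. g' t - 2 * d * t * g t * inverse (1 - t\<^sup>2 - d) ^ 2) t
      = (g' t - 2 * d * t * g t * inverse (x t) ^ 2) * exp (- (d / x t))"
    using greater by (simp add: cutoff_def x_def)
  moreover have "g' t * E + E * (- 2 * d * t / y\<^sup>2) * g t = (g' t - 2 * d * t * g t * inverse y ^ 2) * E" for E y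
    by (simp add: divide_inverse power_inverse left_diff_distrib)
  ultimately have "((\<lambda>t. g t * exp (- (d / x t))) has_real_derivative
      cutoff d (\<lambda>t. g' t - 2 * d * t * g t * inverse (1 - t\<^sup>2 - d) ^ 2) t) (at t)" by simp
  then show ?thesis
  proof (rule has_field_derivative_transform_within_open)
    show "open {s. d < 1 - s\<^sup>2}" by (intro open_Collect_less continuous_intros)
  qed (use greater in \<open>auto simp: cutoff_def x_def\<close>)
next
  case less
  have "((\<lambda>t. 0 :: real) has_real_derivative 0) (at t)" by simp
  then have "(cutoff d g has_real_derivative 0) (at t)"
  proof (rule has_field_derivative_transform_within_open)
    show "open {s. 1 - s\<^sup>2 < d}" by (intro open_Collect_less continuous_intros)
  qed (use less in \<open>auto simp: cutoff_def\<close>)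
  with less show ?thesis by (simp add: cutoff_def)
next
  case equal
  obtain K where K: "\<And>s. \<bar>cutoff d g s\<bar> \<le> K * (1 - s\<^sup>2 - d)\<^sup>2"
    by (rule cutoff_flat[OF g \<open>0 < d\<close>]) blast
  have "\<bar>t\<bar> \<le> 1" using equal \<open>0 < d\<close> abs_square_le_1[of t] by simp
  have "\<bar>cutoff d g s\<bar> \<le> (\<bar>K\<bar> * 9) * (s - t)\<^sup>2" if "\<bar>s - t\<bar> < 1" for s
  proof -
    have "1 - s\<^sup>2 - d = - ((s + t) * (s - t))"
      unfolding equal[symmetric] by (simp add: algebra_simps power2_eq_square)
    then have sq: "(1 - s\<^sup>2 - d)\<^sup>2 = (s + t)\<^sup>2 * (s - t)\<^sup>2"
      by (simp only: power2_minus power_mult_distrib)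
    have "\<bar>s + t\<bar> \<le> 3" using that \<open>\<bar>t\<bar> \<le> 1\<close> by linarith
    then have "(s + t)\<^sup>2 \<le> 3\<^sup>2" using abs_le_square_iff[of "s + t" 3] by simp
    then have "(s + t)\<^sup>2 * (s - t)\<^sup>2 \<le> 9 * (s - t)\<^sup>2" by (intro mult_right_mono) auto
    then have "\<bar>K\<bar> * (1 - s\<^sup>2 - d)\<^sup>2 \<le> \<bar>K\<bar> * (9 * (s - t)\<^sup>2)"
      unfolding sq by (intro mult_left_mono) auto
    moreover have "K * (1 - s\<^sup>2 - d)\<^sup>2 \<le> \<bar>K\<bar> * (1 - s\<^sup>2 - d)\<^sup>2"
      by (intro mult_right_mono) auto
    moreover have "(\<bar>K\<bar> * 9) * (s - t)\<^sup>2 = \<bar>K\<bar> * (9 * (s - t)\<^sup>2)"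
      by (rule mult.assoc)
    ultimately show ?thesis using K[of s] by linarith
  qed
  then have "(cutoff d g has_real_derivative 0) (at t)"
    by (rule DERIV_zero_if_quadratic)
  with equal show ?thesis by (simp add: cutoff_def)
qed

lemma test_function_cutoff:
  assumes g: "cutoff_amplitude d g" and "0 < d"
  shows "test_function (cutoff d g)"
  unfolding test_function_def
proof (intro conjI allI)
  have closed_under_deriv: "\<exists>h. cutoff_amplitude d h \<and> (deriv ^^ k) (cutoff d g) = cutoff d h" for k
  proof (induction k)
    case 0
    show ?case using g by auto
  next
    case (Suc k)
    then obtain h where h: "cutoff_amplitude d h" "(deriv ^^ k) (cutoff d g) = cutoff d h" by blast
    obtain h' where h': "cutoff_amplitude d h'" "\<And>t. d < 1 - t\<^sup>2 \<Longrightarrow> (h has_real_derivative h' t) (at t)"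
      using cutoff_amplitude_derivative[OF h(1) \<open>0 < d\<close>] by blast
    let ?h = "\<lambda>t. h' t + poly [:0, -2 * d:] t * h t * inverse (1 - t\<^sup>2 - d) ^ 2"
    have "cutoff_amplitude d ?h"
      by (intro cutoff_amplitude.intros amp_power h h')
    moreover have "deriv (cutoff d h) = cutoff d ?h"
      by (rule ext, rule DERIV_imp_deriv) (use DERIV_cutoff[OF h(1) \<open>0 < d\<close> h'(2)] in \<open>simp add: mult_ac\<close>)
    ultimately show ?case using h(2) by auto
  qed
  show "(deriv ^^ k) (cutoff d g) differentiable at t" for k t
  proof -
    obtain h where h: "cutoff_amplitude d h" "(deriv ^^ k) (cutoff d g) = cutoff d h"
      using closed_under_deriv by blast
    obtain h' where "\<And>t. d < 1 - t\<^sup>2 \<Longrightarrow> (h has_real_derivative h' t) (at t)"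
      using cutoff_amplitude_derivative[OF h(1) \<open>0 < d\<close>] by blast
    from DERIV_cutoff[OF h(1) \<open>0 < d\<close> this] show ?thesis
      unfolding h(2) real_differentiable_def by blast
  qed
  have "closed {t. d \<le> 1 - t\<^sup>2}"
    by (intro closed_Collect_le continuous_intros)
  then have supp: "closure {t. cutoff d g t \<noteq> 0} \<subseteq> {t. d \<le> 1 - t\<^sup>2}"
    by (intro closure_minimal) (auto simp: cutoff_def)
  also have inside: "\<dots> \<subseteq> open_ivl"
  proof
    fix t assume "t \<in> {t. d \<le> 1 - t\<^sup>2}"
    with \<open>0 < d\<close> have "t\<^sup>2 < 1" by simp
    then show "t \<in> open_ivl" by (simp only: square_less_1_iff)
  qed
  finally show "closure {t. cutoff d g t \<noteq> 0} \<subseteq> open_ivl" .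
  then show "compact (closure {t. cutoff d g t \<noteq> 0})"
    unfolding compact_eq_bounded_closed using bounded_subset[OF bounded_Ioo] by blast
qed

section \<open>Testing weak derivatives against functions vanishing at the end points\<close>

lemma L2_inner_bounded_convergence:
  fixes G :: "nat \<Rightarrow> real \<Rightarrow> real"
  assumes U: "U \<in> L2" and G: "\<And>i. G i \<in> borel_measurable \<mu>"
    and bound: "\<And>i t. t \<in> open_ivl \<Longrightarrow> \<bar>G i t\<bar> \<le> C"
    and lim: "\<And>t. t \<in> open_ivl \<Longrightarrow> (\<lambda>i. G i t) \<longlonglongrightarrow> H t"
  shows "(\<lambda>i. L2_inner U (G i)) \<longlonglongrightarrow> L2_inner U H"
  unfolding L2_inner_def
proof (rule integral_dominated_convergence)
  have H: "H \<in> borel_measurable \<mu>"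
    by (rule borel_measurable_LIMSEQ_real[OF _ G]) (use lim in simp)
  show "(\<lambda>t. U t * H t) \<in> borel_measurable \<mu>"
    by (intro borel_measurable_times H L2D(1)[OF U])
  show "(\<lambda>t. U t * G i t) \<in> borel_measurable \<mu>" for i
    by (intro borel_measurable_times G L2D(1)[OF U])
  show "integrable \<mu> (\<lambda>t. \<bar>U t\<bar> * C)"
    by (intro integrable_mult_left integrable_abs L2_imp_integrable U)
  show "AE t in \<mu>. (\<lambda>i. U t * G i t) \<longlonglongrightarrow> U t * H t"
    by (rule AE_I2) (auto intro!: tendsto_mult_left lim)
  show "AE t in \<mu>. norm (U t * G i t) \<le> \<bar>U t\<bar> * C" for i
    by (rule AE_I2) (use bound in \<open>auto simp: abs_mult intro!: mult_left_mono\<close>)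
qed

lemma DERIV_omega_power_poly:
  assumes "1 \<le> m" "t \<in> open_ivl"
  shows "((\<lambda>t. \<omega> t ^ m * poly q t) has_real_derivative
            inverse (\<omega> t) * (\<omega> t ^ (m - 1) * poly (ang_deriv m q) t)) (at t)"
proof -
  obtain l where m: "m = Suc l" using assms(1) by (cases m) auto
  define w where "w = \<omega> t"
  have "w \<noteq> 0" using omega_pos[OF assms(2)] by (simp add: w_def)
  have "((\<lambda>t. \<omega> t ^ m * poly q t) has_real_derivative
       (of_nat m * (- t * inverse (\<omega> t) * \<omega> t ^ (m - Suc 0))) * poly q t + poly (pderiv q) t * \<omega> t ^ m) (at t)"
    by (intro DERIV_mult DERIV_power DERIV_omega[OF assms(2)] poly_DERIV)
  moreover have "(of_nat m * (- t * inverse w * w ^ (m - Suc 0))) * poly q t + poly (pderiv q) t * w ^ m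
      = inverse w * (w ^ (m - 1) * (w * w * poly (pderiv q) t - real m * (t * poly q t)))"
    using \<open>w \<noteq> 0\<close> by (simp add: m right_diff_distrib mult_ac)
  moreover have "w * w * poly (pderiv q) t - real m * (t * poly q t) = poly (ang_deriv m q) t"
    unfolding w_def omega_square[OF assms(2)] by (simp add: ang_deriv_def)
  ultimately show ?thesis by (simp only: w_def)
qed

text \<open>
  With \<open>y = d / (\<omega>\<^sup>2 - d)\<close> the left-hand side is \<open>\<omega>\<^sup>2\<close> times the derivative of the cut-off with respect to
  \<open>\<omega>\<^sup>2\<close>. Its boundedness, uniform in \<open>d\<close>, makes dominated convergence applicable as \<open>d \<rightarrow> 0\<close>.
\<close>

lemma exp_weight_le_2:
  fixes y :: real
  assumes "0 \<le> y"
  shows "(1 + y) * y * exp (- y) \<le> 2"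
proof -
  have "(1 + y) * y \<le> 2 * (1 + y + y\<^sup>2 / 2)"
    using assms by (simp add: algebra_simps power2_eq_square)
  also have "\<dots> \<le> 2 * exp y"
    using exp_lower_Taylor_quadratic[OF assms] by simp
  finally show ?thesis by (simp add: exp_minus field_simps)
qed

text \<open>
  The weak derivative may be tested against \<open>\<psi> = \<omega>\<^sup>m q\<close>, which is not compactly supported. Cutting \<open>\<psi>\<close> off
  produces an extra term \<open>u \<psi> \<chi>'\<close>. It is bounded by a multiple of \<open>\<bar>u / \<omega>\<bar>\<close> because \<open>\<psi> / \<omega>\<close>
  is bounded for \<open>m \<ge> 1\<close> and \<open>\<omega>\<^sup>2 \<chi>'\<close> is bounded, and it tends to zero pointwise.
\<close>

lemma weak_derivative_against_omega_power:
  assumes uv: "distributional_deriv u v"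
    and U: "(\<lambda>t. inverse (\<omega> t) * u t) \<in> L2" and V: "(\<lambda>t. \<omega> t * v t) \<in> L2" and "1 \<le> m"
  shows "L2_inner (\<lambda>t. inverse (\<omega> t) * u t) (\<lambda>t. \<omega> t ^ (m - 1) * poly (ang_deriv m q) t)
           = - L2_inner (\<lambda>t. \<omega> t * v t) (\<lambda>t. \<omega> t ^ (m - 1) * poly q t)"
proof -
  define a where "a = (\<lambda>t. \<omega> t ^ (m - 1) * poly (ang_deriv m q) t)"
  define b where "b = (\<lambda>t. \<omega> t ^ (m - 1) * poly q t)"
  define g where "g = (\<lambda>t. \<omega> t ^ m * poly q t)"
  define g' where "g' = (\<lambda>t. inverse (\<omega> t) * a t)"
  define d where "d = (\<lambda>i. inverse (real (Suc i)))"
  \<comment> \<open>The weights \<open>\<omega>\<close> are distributed so that the cut-off identity pairs \<open>u / \<omega>\<close> with \<open>G i\<close> and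
    \<open>\<omega> v\<close> with \<open>F i\<close>; all estimates are in terms of \<open>y i\<close>, which tends to \<open>0\<close>.\<close>
  define y where "y = (\<lambda>i t. d i / (1 - t\<^sup>2 - d i))"
  define G where "G = (\<lambda>i t. \<omega> t * deriv (cutoff (d i) g) t)"
  define F where "F = (\<lambda>i t. inverse (\<omega> t) * cutoff (d i) g t)"
  have d_pos: "0 < d i" for i by (simp add: d_def)
  have d_lim: "d \<longlonglongrightarrow> 0" unfolding d_def by (rule LIMSEQ_inverse_real_of_nat)
  have amp: "cutoff_amplitude (d i) g" for i
    unfolding g_def by (intro cutoff_amplitude.intros amp_power)
  have g: "(g has_real_derivative g' t) (at t)" if "d i < 1 - t\<^sup>2" for i t
  proof -
    have "t \<in> open_ivl" using that d_pos[of i] square_less_1_iff[of t] by simp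
    from DERIV_omega_power_poly[OF \<open>1 \<le> m\<close> this] show ?thesis by (simp only: g_def g'_def a_def)
  qed
  have test: "test_function (cutoff (d i) g)" for i
    by (rule test_function_cutoff[OF amp d_pos])
  have deriv_cutoff: "deriv (cutoff (d i) g) t
      = cutoff (d i) (\<lambda>t. g' t - 2 * d i * t * g t * inverse (1 - t\<^sup>2 - d i) ^ 2) t" for i t
    by (rule DERIV_imp_deriv, rule DERIV_cutoff[OF amp d_pos g])
  have omega_g: "\<omega> t * g t = (1 - t\<^sup>2) * b t" "g t = \<omega> t * b t" if "t \<in> open_ivl" for t
  proof -
    show "g t = \<omega> t * b t"
      using \<open>1 \<le> m\<close> by (cases m) (simp_all add: g_def b_def)
    then show "\<omega> t * g t = (1 - t\<^sup>2) * b t"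
      by (simp add: omega_square[OF that, symmetric])
  qed
  have G_eq: "G i t = (if d i < 1 - t\<^sup>2
      then a t * exp (- y i t) - 2 * t * b t * ((1 + y i t) * y i t * exp (- y i t)) else 0)"
    if "t \<in> open_ivl" for i t
  proof (cases "d i < 1 - t\<^sup>2")
    case True
    define x where "x = 1 - t\<^sup>2 - d i"
    have "0 < x" using True by (simp add: x_def)
    have "G i t = \<omega> t * ((g' t - 2 * d i * t * g t * inverse x ^ 2) * exp (- (d i / x)))"
      using True by (simp add: G_def deriv_cutoff cutoff_def x_def)
    also have "\<dots> = (\<omega> t * g' t - 2 * t * d i * inverse x ^ 2 * (\<omega> t * g t)) * exp (- (d i / x))"
      by (simp add: algebra_simps)
    also have "\<omega> t * g' t = a t" using omega_pos[OF that] by (simp add: g'_def)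
    also have "\<omega> t * g t = (x + d i) * b t" unfolding omega_g(1)[OF that] by (simp add: x_def)
    also have "(a t - 2 * t * d i * inverse x ^ 2 * ((x + d i) * b t)) * exp (- (d i / x))
        = a t * exp (- (d i / x)) - 2 * t * b t * ((1 + d i / x) * (d i / x) * exp (- (d i / x)))"
    proof -
      have "d i * inverse x ^ 2 * (x + d i) = (1 + d i / x) * (d i / x)"
        using \<open>0 < x\<close> by (simp add: field_simps power2_eq_square)
      then have "2 * t * d i * inverse x ^ 2 * ((x + d i) * b t) = 2 * t * b t * ((1 + d i / x) * (d i / x))"
        by (metis (no_types, opaque_lifting) mult.assoc mult.commute)
      then show ?thesis by (simp only: left_diff_distrib mult.assoc)
    qed
    finally show ?thesis using True by (simp add: y_def x_def)
  qed (simp add: G_def deriv_cutoff cutoff_def)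
  have F_eq: "F i t = (if d i < 1 - t\<^sup>2 then b t * exp (- y i t) else 0)" if "t \<in> open_ivl" for i t
    using omega_g(2)[OF that] omega_pos[OF that] by (simp add: F_def cutoff_def y_def)
  obtain C1 where C1: "\<And>t. t \<in> {-1..1} \<Longrightarrow> \<bar>a t\<bar> \<le> C1"
    by (rule continuous_on_ivl_bounded[of a]) (auto simp: a_def intro!: continuous_intros)
  obtain C2 where C2: "\<And>t. t \<in> {-1..1} \<Longrightarrow> \<bar>b t\<bar> \<le> C2"
    by (rule continuous_on_ivl_bounded[of b]) (auto simp: b_def intro!: continuous_intros)
  have C_nonneg: "0 \<le> C1" "0 \<le> C2" using C1[of 0] C2[of 0] by auto
  have y_nonneg: "0 \<le> y i t" if "d i < 1 - t\<^sup>2" for i t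
    using that d_pos[of i] by (simp add: y_def)
  have G_bound: "\<bar>G i t\<bar> \<le> C1 + 4 * C2" if t: "t \<in> open_ivl" for i t
  proof (cases "d i < 1 - t\<^sup>2")
    case True
    have "\<bar>a t\<bar> * exp (- y i t) \<le> C1 * 1"
      using C1[of t] t y_nonneg[OF True] C_nonneg by (intro mult_mono) auto
    moreover have "\<bar>2 * t * b t\<bar> * ((1 + y i t) * y i t * exp (- y i t)) \<le> (2 * C2) * 2"
    proof (intro mult_mono exp_weight_le_2 y_nonneg[OF True])
      have "\<bar>t\<bar> * \<bar>b t\<bar> \<le> 1 * C2" using C2[of t] t by (intro mult_mono) auto
      then show "\<bar>2 * t * b t\<bar> \<le> 2 * C2" by (simp add: abs_mult)
    qed (use C_nonneg y_nonneg[OF True] in auto)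
    moreover have "\<bar>G i t\<bar> \<le> \<bar>a t * exp (- y i t)\<bar> + \<bar>2 * t * b t * ((1 + y i t) * y i t * exp (- y i t))\<bar>"
      using True by (simp add: G_eq[OF t] abs_triangle_ineq4)
    moreover have "\<bar>(1 + y i t) * y i t * exp (- y i t)\<bar> = (1 + y i t) * y i t * exp (- y i t)"
      using y_nonneg[OF True] by simp
    ultimately show ?thesis unfolding abs_mult[of "a t"] abs_mult[of "2 * t * b t"] by simp
  qed (use C_nonneg in \<open>simp add: G_eq[OF t]\<close>)
  have F_bound: "\<bar>F i t\<bar> \<le> C2" if t: "t \<in> open_ivl" for i t
  proof (cases "d i < 1 - t\<^sup>2")
    case True
    have "\<bar>b t\<bar> * exp (- y i t) \<le> C2 * 1"
      using C2[of t] t y_nonneg[OF True] C_nonneg by (intro mult_mono) auto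
    then show ?thesis using True by (simp add: F_eq[OF t] abs_mult)
  qed (use C_nonneg in \<open>simp add: F_eq[OF t]\<close>)
  have y_lim: "(\<lambda>i. y i t) \<longlonglongrightarrow> 0" and d_small: "\<forall>\<^sub>F i in sequentially. d i < 1 - t\<^sup>2"
    if "t \<in> open_ivl" for t
  proof -
    have pos: "0 < 1 - t\<^sup>2" using that square_less_1_iff[of t] by simp
    then show "\<forall>\<^sub>F i in sequentially. d i < 1 - t\<^sup>2"
      using order_tendstoD(2)[OF d_lim] by blast
    have "(\<lambda>i. y i t) \<longlonglongrightarrow> 0 / (1 - t\<^sup>2 - 0)"
      unfolding y_def using pos by (intro tendsto_intros d_lim) simp
    then show "(\<lambda>i. y i t) \<longlonglongrightarrow> 0" by simp
  qed
  have G_lim: "(\<lambda>i. G i t) \<longlonglongrightarrow> a t" if t: "t \<in> open_ivl" for t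
  proof (rule Lim_transform_eventually)
    have "(\<lambda>i. a t * exp (- y i t) - 2 * t * b t * ((1 + y i t) * y i t * exp (- y i t)))
        \<longlonglongrightarrow> a t * exp (- 0) - 2 * t * b t * ((1 + 0) * 0 * exp (- 0))"
      by (intro tendsto_intros y_lim t)
    then show "(\<lambda>i. a t * exp (- y i t) - 2 * t * b t * ((1 + y i t) * y i t * exp (- y i t))) \<longlonglongrightarrow> a t"
      by simp
    show "\<forall>\<^sub>F i in sequentially. a t * exp (- y i t) - 2 * t * b t * ((1 + y i t) * y i t * exp (- y i t)) = G i t"
      using d_small[OF t] by eventually_elim (simp add: G_eq[OF t])
  qed
  have F_lim: "(\<lambda>i. F i t) \<longlonglongrightarrow> b t" if t: "t \<in> open_ivl" for t
  proof (rule Lim_transform_eventually)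
    have "(\<lambda>i. b t * exp (- y i t)) \<longlonglongrightarrow> b t * exp (- 0)"
      by (intro tendsto_intros y_lim t)
    then show "(\<lambda>i. b t * exp (- y i t)) \<longlonglongrightarrow> b t" by simp
    show "\<forall>\<^sub>F i in sequentially. b t * exp (- y i t) = F i t"
      using d_small[OF t] by eventually_elim (simp add: F_eq[OF t])
  qed
  have smooth: "continuous_on S ((deriv ^^ k) (cutoff (d i) g))" for S i k
    using test[of i] unfolding test_function_def
    by (intro differentiable_imp_continuous_on) (simp add: differentiable_on_def differentiable_at_withinI)
  have G_meas: "G i \<in> borel_measurable \<mu>" for i
    unfolding G_def using smooth[of _ 1 i]
    by (intro measurable_\<mu>_continuous continuous_intros) simp
  have F_meas: "F i \<in> borel_measurable \<mu>" for i
    unfolding F_def using smooth[of _ 0 i] omega_pos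
    by (intro measurable_\<mu>_continuous continuous_intros) force+
  have "L2_inner (\<lambda>t. inverse (\<omega> t) * u t) (G i) = - L2_inner (\<lambda>t. \<omega> t * v t) (F i)" for i
  proof -
    have "L2_inner (\<lambda>t. inverse (\<omega> t) * u t) (G i) = L2_inner u (deriv (cutoff (d i) g))"
      using omega_pos by (intro L2_inner_cong) (force simp: G_def)
    also have "\<dots> = - L2_inner v (cutoff (d i) g)"
      using uv test[of i] unfolding distributional_deriv_def L2_inner_def by blast
    also have "L2_inner v (cutoff (d i) g) = L2_inner (\<lambda>t. \<omega> t * v t) (F i)"
      using omega_pos by (intro L2_inner_cong) (force simp: F_def)
    finally show ?thesis .
  qed
  moreover have "(\<lambda>i. L2_inner (\<lambda>t. inverse (\<omega> t) * u t) (G i)) \<longlonglongrightarrow> L2_inner (\<lambda>t. inverse (\<omega> t) * u t) a"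
    by (rule L2_inner_bounded_convergence[OF U G_meas G_bound G_lim])
  moreover have "(\<lambda>i. - L2_inner (\<lambda>t. \<omega> t * v t) (F i)) \<longlonglongrightarrow> - L2_inner (\<lambda>t. \<omega> t * v t) b"
    by (intro tendsto_minus L2_inner_bounded_convergence[OF V F_meas F_bound F_lim])
  ultimately show ?thesis
    unfolding a_def[symmetric] b_def[symmetric] using LIMSEQ_unique by simp
qed

section \<open>Bessel inequality for the energy\<close>

text \<open>
  Pythagoras for the energy form.
\<close>

lemma energy_sum:
  fixes c :: "nat \<Rightarrow> real"
  assumes "1 \<le> m" "finite F" "F \<subseteq> {m..}"
  defines "S \<equiv> \<lambda>t. \<Sum>n\<in>F. c n * assoc_dQ n m t" and "T \<equiv> \<lambda>t. \<Sum>n\<in>F. c n * assoc_Qw n m t"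
  shows "L2_inner S S + (real m)\<^sup>2 * L2_inner T T = (\<Sum>n\<in>F. real n * (real n + 1) * (c n)\<^sup>2)"
proof -
  have SS: "L2_inner (\<lambda>t. \<Sum>k\<in>F. c k * f k t) (\<lambda>t. \<Sum>n\<in>F. c n * f n t)
       = (\<Sum>k\<in>F. \<Sum>n\<in>F. c k * (c n * L2_inner (f k) (f n)))"
    if f: "\<And>n. f n \<in> L2" for f :: "nat \<Rightarrow> real \<Rightarrow> real"
  proof -
    have "L2_inner (\<lambda>t. \<Sum>k\<in>F. c k * f k t) (\<lambda>t. \<Sum>n\<in>F. c n * f n t)
        = (\<Sum>k\<in>F. c k * L2_inner (f k) (\<lambda>t. \<Sum>n\<in>F. c n * f n t))"
      by (subst L2_inner_sum_left) (simp_all add: L2_scale L2_sum f L2_inner_scale_left)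
    also have "\<dots> = (\<Sum>k\<in>F. c k * (\<Sum>n\<in>F. c n * L2_inner (f k) (f n)))"
      by (subst L2_inner_commute, subst L2_inner_sum_left)
         (simp_all add: L2_scale f L2_inner_scale_left L2_inner_commute)
    finally show ?thesis by (simp add: sum_distrib_left)
  qed
  have "L2_inner S S + (real m)\<^sup>2 * L2_inner T T
      = (\<Sum>k\<in>F. \<Sum>n\<in>F. c k * (c n * (L2_inner (assoc_dQ k m) (assoc_dQ n m)
            + (real m)\<^sup>2 * L2_inner (assoc_Qw k m) (assoc_Qw n m))))"
    unfolding S_def T_def SS[OF L2_assoc(2)] SS[OF L2_assoc(3)]
    by (simp add: sum_distrib_left sum.distrib distrib_left mult_ac)
  also have "\<dots> = (\<Sum>k\<in>F. \<Sum>n\<in>F. if k = n then real n * (real n + 1) * (c n)\<^sup>2 else 0)"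
  proof (intro sum.cong refl)
    fix k n assume "k \<in> F" "n \<in> F"
    then have "m \<le> n" using assms(3) by auto
    then show "c k * (c n * (L2_inner (assoc_dQ k m) (assoc_dQ n m)
            + (real m)\<^sup>2 * L2_inner (assoc_Qw k m) (assoc_Qw n m)))
          = (if k = n then real n * (real n + 1) * (c n)\<^sup>2 else 0)"
      unfolding assoc_Q_energy[OF assms(1) \<open>m \<le> n\<close>] by (simp add: power2_eq_square)
  qed
  also have "\<dots> = (\<Sum>n\<in>F. real n * (real n + 1) * (c n)\<^sup>2)"
    using assms(2) by simp
  finally show ?thesis .
qed

text \<open>
  The weak derivative is tested against \<open>\<omega>\<^sup>m q\<close> with \<open>q = D p\<close>, and \<open>D q\<close> is given by the eigenvalue
  equation.
\<close>

lemma weak_energy_identity: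
  assumes uv: "distributional_deriv u v"
    and U: "(\<lambda>t. inverse (\<omega> t) * u t) \<in> L2" and V: "(\<lambda>t. \<omega> t * v t) \<in> L2" and "1 \<le> m"
  shows "L2_inner (\<lambda>t. \<omega> t * v t) (assoc_dQ n m)
           + (real m)\<^sup>2 * L2_inner (\<lambda>t. inverse (\<omega> t) * u t) (assoc_Qw n m)
         = real n * (real n + 1) * L2_inner u (assoc_Q n m)"
proof -
  let ?U = "\<lambda>t. inverse (\<omega> t) * u t" and ?p = "assoc_poly n m"
  have "L2_inner ?U (\<lambda>t. \<omega> t ^ (m - 1) * poly (ang_deriv m (ang_deriv m ?p)) t)
      = L2_inner (\<lambda>t. (real m)\<^sup>2 * assoc_Qw n m t - real n * (real n + 1) * (\<omega> t * assoc_Q n m t)) ?U"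
  proof -
    have "\<omega> t ^ (m - 1) * poly (ang_deriv m (ang_deriv m ?p)) t
        = (real m)\<^sup>2 * assoc_Qw n m t - real n * (real n + 1) * (\<omega> t * assoc_Q n m t)"
      if "t \<in> open_ivl" for t
    proof -
      have e: "\<omega> t * assoc_Q n m t = (1 - t\<^sup>2) * assoc_Qw n m t"
        unfolding assoc_Q_eq_omega_Qw[OF \<open>1 \<le> m\<close>] omega_square[OF that, symmetric] by (rule mult.assoc[symmetric])
      show ?thesis
        unfolding e by (simp add: ang_deriv_ang_deriv_assoc_poly assoc_Qw_def algebra_simps)
    qed
    then show ?thesis by (intro L2_inner_cong) (simp only: mult.commute)
  qed
  also have "\<dots> = (real m)\<^sup>2 * L2_inner (assoc_Qw n m) ?U
      - real n * (real n + 1) * L2_inner (\<lambda>t. \<omega> t * assoc_Q n m t) ?U"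
  proof -
    have "(\<lambda>t. \<omega> t * assoc_Q n m t) \<in> L2"
      unfolding assoc_Q_eq_poly by (intro L2_continuous continuous_intros)
    then show ?thesis
      by (subst L2_inner_diff_left) (simp_all only: L2_scale L2_assoc U L2_inner_scale_left)
  qed
  also have "L2_inner (\<lambda>t. \<omega> t * assoc_Q n m t) ?U = L2_inner u (assoc_Q n m)"
    using omega_pos by (intro L2_inner_cong) force
  also have "L2_inner ?U (\<lambda>t. \<omega> t ^ (m - 1) * poly (ang_deriv m (ang_deriv m ?p)) t)
      = - L2_inner (\<lambda>t. \<omega> t * v t) (assoc_dQ n m)"
    unfolding weak_derivative_against_omega_power[OF assms] assoc_dQ_def[abs_def] ..
  finally show ?thesis
    unfolding L2_inner_commute[of "assoc_Qw n m"] by linarith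
qed

text \<open>
  Bessel's inequality for the energy form: the energy of the difference between \<open>u\<close> and a partial sum of
  its expansion is non-negative.
\<close>

lemma Bessel_energy:
  assumes uv: "distributional_deriv u v"
    and U: "(\<lambda>t. inverse (\<omega> t) * u t) \<in> L2" and V: "(\<lambda>t. \<omega> t * v t) \<in> L2"
    and "1 \<le> m" "finite F" "F \<subseteq> {m..}"
  shows "(\<Sum>n\<in>F. real n * (real n + 1) * (L2_inner u (assoc_Q n m))\<^sup>2)
     \<le> L2_inner (\<lambda>t. \<omega> t * v t) (\<lambda>t. \<omega> t * v t)
       + (real m)\<^sup>2 * L2_inner (\<lambda>t. inverse (\<omega> t) * u t) (\<lambda>t. inverse (\<omega> t) * u t)"
proof -
  define f g where "f = (\<lambda>t. \<omega> t * v t)" and "g = (\<lambda>t. inverse (\<omega> t) * u t)"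
  have f: "f \<in> L2" and g: "g \<in> L2" using U V by (simp_all add: f_def g_def)
  define c where "c = (\<lambda>n. L2_inner u (assoc_Q n m))"
  define S T where "S = (\<lambda>t. \<Sum>n\<in>F. c n * assoc_dQ n m t)" and "T = (\<lambda>t. \<Sum>n\<in>F. c n * assoc_Qw n m t)"
  have S: "S \<in> L2" and T: "T \<in> L2"
    unfolding S_def T_def by (intro L2_sum L2_scale L2_assoc)+
  have square: "L2_inner (\<lambda>t. h t - R t) (\<lambda>t. h t - R t) = L2_inner h h - 2 * L2_inner R h + L2_inner R R"
    if "h \<in> L2" "R \<in> L2" for h R
  proof -
    have D: "(\<lambda>t. h t - R t) \<in> L2" by (rule L2_diff[OF that])
    note L2_inner_diff_left[OF that D] L2_inner_diff_left[OF that that(1)] L2_inner_diff_left[OF that that(2)]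
    then show ?thesis
      unfolding L2_inner_commute[of h "\<lambda>t. h t - R t"] L2_inner_commute[of R "\<lambda>t. h t - R t"]
        L2_inner_commute[of h R] by linarith
  qed
  have "L2_inner S f + (real m)\<^sup>2 * L2_inner T g
      = (\<Sum>n\<in>F. c n * (L2_inner f (assoc_dQ n m) + (real m)\<^sup>2 * L2_inner g (assoc_Qw n m)))"
    unfolding S_def T_def
    unfolding L2_inner_commute[of f] L2_inner_commute[of g]
    by (simp add: L2_inner_sum_left L2_scale L2_assoc f g L2_inner_scale_left sum_distrib_left sum.distrib
        distrib_left mult_ac)
  also have "\<dots> = (\<Sum>n\<in>F. real n * (real n + 1) * (c n)\<^sup>2)"
    unfolding f_def g_def weak_energy_identity[OF uv U V \<open>1 \<le> m\<close>] c_def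
    by (simp add: power2_eq_square mult_ac)
  finally have cross: "L2_inner S f + (real m)\<^sup>2 * L2_inner T g = (\<Sum>n\<in>F. real n * (real n + 1) * (c n)\<^sup>2)" .
  have "L2_inner S S + (real m)\<^sup>2 * L2_inner T T = (\<Sum>n\<in>F. real n * (real n + 1) * (c n)\<^sup>2)"
    unfolding S_def T_def by (rule energy_sum[OF assms(4-6)])
  moreover have "0 \<le> L2_inner (\<lambda>t. f t - S t) (\<lambda>t. f t - S t)"
    by (rule L2_inner_self_nonneg)
  moreover have "0 \<le> (real m)\<^sup>2 * L2_inner (\<lambda>t. g t - T t) (\<lambda>t. g t - T t)"
    by (intro mult_nonneg_nonneg L2_inner_self_nonneg) simp
  ultimately have "(\<Sum>n\<in>F. real n * (real n + 1) * (c n)\<^sup>2) \<le> L2_inner f f + (real m)\<^sup>2 * L2_inner g g"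
    using cross unfolding square[OF f S] square[OF g T] distrib_left right_diff_distrib
    by linarith
  then show ?thesis by (simp add: c_def f_def g_def)
qed

lemma omega_inverse_mult: "t \<in> open_ivl \<Longrightarrow> \<omega> t * (inverse (\<omega> t) * x) = x"
  using omega_pos[of t] by simp

lemma L2_omega_mult:
  assumes "h \<in> L2"
  shows "(\<lambda>t. \<omega> t * h t) \<in> L2"
  by (rule L2_mult_bounded[where C = 1, OF assms])
     (use omega_pos omega_le_1 in \<open>auto intro!: measurable_\<mu>_continuous continuous_intros simp: abs_of_pos\<close>)

text \<open>
  Bessel's inequality suffices because \<open>(2 n + 1)\<^sup>2 \<le> 5 n (n + 1)\<close> for \<open>n \<ge> 1\<close>.
\<close>

lemma Y_space_subset_H_space:
  assumes "1 \<le> m"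
  shows "Y_space \<subseteq> H_space m 1"
proof
  fix u assume "u \<in> Y_space"
  then obtain v where U: "(\<lambda>t. inverse (\<omega> t) * u t) \<in> L2" and uv: "distributional_deriv u v"
      and V: "(\<lambda>t. \<omega> t * v t) \<in> L2"
    unfolding Y_space_def by blast
  have "(\<lambda>t. \<omega> t * (inverse (\<omega> t) * u t)) \<in> L2"
    by (rule L2_omega_mult[OF U])
  then have "u \<in> L2"
    using L2_cong[of "\<lambda>t. \<omega> t * (inverse (\<omega> t) * u t)" u] omega_inverse_mult by blast
  moreover have "(\<lambda>n. real (2 * n + 1) powr (2 * 1) * (L2_inner u (assoc_Q n m))\<^sup>2) summable_on {m..}"
  proof (rule nonneg_bdd_above_summable_on)
    let ?E = "L2_inner (\<lambda>t. \<omega> t * v t) (\<lambda>t. \<omega> t * v t)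
       + (real m)\<^sup>2 * L2_inner (\<lambda>t. inverse (\<omega> t) * u t) (\<lambda>t. inverse (\<omega> t) * u t)"
    show "bdd_above (sum (\<lambda>n. real (2 * n + 1) powr (2 * 1) * (L2_inner u (assoc_Q n m))\<^sup>2)
            ` {F. F \<subseteq> {m..} \<and> finite F})"
    proof (rule bdd_aboveI2)
      fix F assume F: "F \<in> {F. F \<subseteq> {m..} \<and> finite F}"
      have "(\<Sum>n\<in>F. real (2 * n + 1) powr (2 * 1) * (L2_inner u (assoc_Q n m))\<^sup>2)
         \<le> (\<Sum>n\<in>F. 5 * (real n * (real n + 1) * (L2_inner u (assoc_Q n m))\<^sup>2))"
      proof (rule sum_mono)
        fix n assume "n \<in> F"
        with F assms have "1 \<le> n" by auto
        then have "1 * 1 \<le> real n * real n" by (intro mult_mono) auto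
        then have "(real (2 * n + 1))\<^sup>2 \<le> 5 * (real n * (real n + 1))"
          by (simp add: power2_eq_square algebra_simps)
        then have "(real (2 * n + 1))\<^sup>2 * (L2_inner u (assoc_Q n m))\<^sup>2
            \<le> 5 * (real n * (real n + 1)) * (L2_inner u (assoc_Q n m))\<^sup>2"
          by (rule mult_right_mono) simp
        then show "real (2 * n + 1) powr (2 * 1) * (L2_inner u (assoc_Q n m))\<^sup>2
            \<le> 5 * (real n * (real n + 1) * (L2_inner u (assoc_Q n m))\<^sup>2)"
          by (simp add: mult.assoc)
      qed
      also have "\<dots> = 5 * (\<Sum>n\<in>F. real n * (real n + 1) * (L2_inner u (assoc_Q n m))\<^sup>2)"
        by (rule sum_distrib_left[symmetric])
      also have "\<dots> \<le> 5 * ?E"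
        using Bessel_energy[OF uv U V assms, of F] F by simp
      finally show "(\<Sum>n\<in>F. real (2 * n + 1) powr (2 * 1) * (L2_inner u (assoc_Q n m))\<^sup>2) \<le> 5 * ?E" .
    qed
  qed simp
  ultimately show "u \<in> H_space m 1" by (simp add: H_space_def)
qed

section \<open>Convergence of expansions in the energy norm\<close>

lemma L2_compact_support:
  assumes "compact K" "K \<subseteq> open_ivl" "continuous_on open_ivl h" "\<And>t. t \<notin> K \<Longrightarrow> h t = 0"
  shows "h \<in> L2"
proof -
  have "bounded (h ` K)"
    by (rule compact_imp_bounded[OF compact_continuous_image[OF continuous_on_subset[OF assms(3,2)] assms(1)]])
  then obtain C where C: "\<forall>y\<in>h ` K. norm y \<le> C"
    unfolding bounded_iff by blast
  have "\<bar>h t\<bar> \<le> \<bar>C\<bar>" for t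
  proof (cases "t \<in> K")
    case True
    with C have "norm (h t) \<le> C" by blast
    then show ?thesis by simp
  qed (simp add: assms(4))
  then show ?thesis
    by (intro L2_bounded[of _ "\<bar>C\<bar>"] measurable_\<mu>_continuous assms)
qed

lemma test_functionD:
  assumes "test_function \<phi>"
  obtains K where "compact K" "K \<subseteq> open_ivl" "\<And>t. t \<notin> K \<Longrightarrow> \<phi> t = 0" "\<And>t. t \<notin> K \<Longrightarrow> deriv \<phi> t = 0"
    "\<And>t. (\<phi> has_real_derivative deriv \<phi> t) (at t)" "\<And>S. continuous_on S \<phi>" "\<And>S. continuous_on S (deriv \<phi>)"
proof -
  define K where "K = closure {t. \<phi> t \<noteq> 0}"
  have diff: "(deriv ^^ k) \<phi> differentiable (at t)" for k t
    using assms by (simp add: test_function_def)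
  have K: "compact K" "K \<subseteq> open_ivl" using assms unfolding test_function_def K_def by blast+
  have zero: "\<phi> t = 0" if "t \<notin> K" for t
    using that closure_subset[of "{t. \<phi> t \<noteq> 0}"] unfolding K_def by blast
  have dzero: "deriv \<phi> t = 0" if "t \<notin> K" for t
  proof (rule DERIV_imp_deriv)
    have "((\<lambda>t. 0 :: real) has_real_derivative 0) (at t)" by simp
    then show "(\<phi> has_real_derivative 0) (at t)"
    proof (rule has_field_derivative_transform_within_open)
      show "open (- K)" unfolding K_def by (intro open_Compl closed_closure)
      show "t \<in> - K" using that by simp
      show "0 = \<phi> s" if "s \<in> - K" for s using zero[of s] that by simp
    qed
  qed
  have der: "(\<phi> has_real_derivative deriv \<phi> t) (at t)" for t
    using diff[of 0 t] by (auto simp: real_differentiable_def DERIV_imp_deriv)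
  have "continuous_on S ((deriv ^^ k) \<phi>)" for S k
    using diff[of k] by (intro differentiable_imp_continuous_on)
      (simp add: differentiable_on_def differentiable_at_withinI)
  from this[of _ 0] this[of _ 1] have cont: "continuous_on S \<phi>" "continuous_on S (deriv \<phi>)" for S by auto
  show thesis
    by (rule that[OF K zero dzero der cont])
qed

text \<open>
  The product \<open>f \<phi>\<close> vanishes near \<open>\<plusminus>1\<close>, so it is differentiable on the closed interval even if \<open>f\<close> is
  singular at the end points.
\<close>

lemma integration_by_parts_test_function:
  assumes test: "test_function \<phi>"
    and f: "\<And>t. t \<in> open_ivl \<Longrightarrow> (f has_real_derivative f' t) (at t)" and f': "continuous_on open_ivl f'"
  shows "L2_inner f (deriv \<phi>) = - L2_inner f' \<phi>"
proof -
  obtain K where K: "compact K" "K \<subseteq> open_ivl" and zero: "\<And>t. t \<notin> K \<Longrightarrow> \<phi> t = 0" "\<And>t. t \<notin> K \<Longrightarrow> deriv \<phi> t = 0"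
    and der: "\<And>t. (\<phi> has_real_derivative deriv \<phi> t) (at t)"
    and cont: "\<And>S. continuous_on S \<phi>" "\<And>S. continuous_on S (deriv \<phi>)"
    using test by (rule test_functionD) blast
  have fc: "continuous_on open_ivl f"
    using f by (intro continuous_at_imp_continuous_on ballI) (blast intro: DERIV_isCont)
  have int: "integrable \<mu> (\<lambda>t. f' t * \<phi> t)" "integrable \<mu> (\<lambda>t. f t * deriv \<phi> t)"
    by (rule L2_imp_integrable, rule L2_compact_support[OF K];
        use zero fc f' cont in \<open>auto intro!: continuous_on_mult\<close>)+
  have "(LINT t|\<mu>. f' t * \<phi> t + f t * deriv \<phi> t) = f 1 * \<phi> 1 - f (-1) * \<phi> (-1)"
  proof (rule integral_\<mu>_derivative)
    show "integrable \<mu> (\<lambda>t. f' t * \<phi> t + f t * deriv \<phi> t)"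
      using int by (rule Bochner_Integration.integrable_add)
    fix t :: real
    show "((\<lambda>t. f t * \<phi> t) has_real_derivative f' t * \<phi> t + f t * deriv \<phi> t) (at t)"
    proof (cases "t \<in> K")
      case True
      then have "t \<in> open_ivl" using K by blast
      from DERIV_mult[OF f[OF this] der[of t]] show ?thesis by (simp add: mult.commute)
    next
      case False
      have "((\<lambda>t. 0 :: real) has_real_derivative 0) (at t)" by simp
      then have "((\<lambda>t. f t * \<phi> t) has_real_derivative 0) (at t)"
      proof (rule has_field_derivative_transform_within_open)
        show "open (- K)" using K compact_imp_closed by blast
      qed (use False zero in auto)
      then show ?thesis using zero False by simp
    qed
  qed
  moreover have "1 \<notin> K" "- 1 \<notin> K" using K by auto
  ultimately have "(LINT t|\<mu>. f' t * \<phi> t + f t * deriv \<phi> t) = 0" using zero by simp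
  then show ?thesis using int by (simp add: L2_inner_def)
qed

lemma locally_integrable_mult_L2:
  assumes g: "g \<in> L2" and b: "continuous_on open_ivl b"
  shows "locally_integrable (\<lambda>t. b t * g t)"
  unfolding locally_integrable_def
proof (intro allI impI)
  fix K assume K: "compact K \<and> K \<subseteq> open_ivl"
  have sets: "K \<in> sets lebesgue" using K by (intro fmeasurableD lmeasurable_compact) simp
  have "set_integrable lebesgue open_ivl g"
    using L2_imp_integrable[OF g] by (simp add: set_integrable_def integrable_restrict_space)
  then have "set_integrable lebesgue K g"
    by (rule set_integrable_subset[OF _ sets conjunct2[OF K]])
  then have gK: "integrable (lebesgue_on K) g"
    using sets by (simp add: set_integrable_def integrable_restrict_space)
  have bK: "continuous_on K b" by (rule continuous_on_subset[OF b conjunct2[OF K]])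
  have "bounded (b ` K)"
    by (rule compact_imp_bounded[OF compact_continuous_image[OF bK conjunct1[OF K]]])
  then obtain C where C: "\<forall>y\<in>b ` K. norm y \<le> C"
    unfolding bounded_iff by blast
  show "integrable (lebesgue_on K) (\<lambda>t. b t * g t)"
  proof (rule Bochner_Integration.integrable_bound)
    show "integrable (lebesgue_on K) (\<lambda>t. C * g t)" by (rule integrable_mult_right[OF gK])
    have "b \<in> borel_measurable (lebesgue_on K)"
      using bK sets by (rule continuous_imp_measurable_on_sets_lebesgue)
    then show "(\<lambda>t. b t * g t) \<in> borel_measurable (lebesgue_on K)"
      by (rule borel_measurable_times[OF _ borel_measurable_integrable[OF gK]])
    have "norm (b t * g t) \<le> norm (C * g t)" if "t \<in> K" for t
    proof -
      have "norm (b t) \<le> C" using C that by blast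
      then have "norm (b t) \<le> \<bar>C\<bar>" by simp
      then show ?thesis by (simp add: abs_mult mult_right_mono)
    qed
    then show "AE t in lebesgue_on K. norm (b t * g t) \<le> norm (C * g t)"
      by (intro AE_I2) (simp add: space_restrict_space)
  qed
qed

lemma summable_energy:
  assumes "u \<in> H_space m 1"
  shows "summable (\<lambda>n. if m \<le> n then real n * (real n + 1) * (L2_inner u (assoc_Q n m))\<^sup>2 else 0)"
proof -
  let ?c = "\<lambda>n. (L2_inner u (assoc_Q n m))\<^sup>2"
  have "(\<lambda>n. real (2 * n + 1) powr (2 * 1) * ?c n) summable_on {m..}"
    using assms by (simp add: H_space_def)
  then have "(\<lambda>n. if m \<le> n then (real (2 * n + 1))\<^sup>2 * ?c n else 0) summable_on UNIV"
    by (rule summable_on_cong_neutral[THEN iffD1, rotated 3]) auto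
  then have "summable (\<lambda>n. if m \<le> n then (real (2 * n + 1))\<^sup>2 * ?c n else 0)"
    by (subst (asm) summable_on_UNIV_nonneg_real_iff) auto
  then show ?thesis
  proof (rule summable_comparison_test'[where N = 0])
    fix n
    have "real n * (real n + 1) \<le> (real (2 * n + 1))\<^sup>2"
      by (simp add: power2_eq_square algebra_simps)
    then have "real n * (real n + 1) * ?c n \<le> (real (2 * n + 1))\<^sup>2 * ?c n"
      by (rule mult_right_mono) simp
    then show "norm (if m \<le> n then real n * (real n + 1) * ?c n else 0)
        \<le> (if m \<le> n then (real (2 * n + 1))\<^sup>2 * ?c n else 0)"
      by simp
  qed
qed

text \<open>
  The constant \<open>C\<close> allows the lemma to be applied to either of the two summands of the energy.
\<close>

lemma L2_Cauchy_partial_sums: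
  fixes f :: "nat \<Rightarrow> real \<Rightarrow> real" and c a :: "nat \<Rightarrow> real"
  assumes f: "\<And>n. f n \<in> L2" and a: "summable a" "\<And>n. 0 \<le> a n" and "0 < C"
    and bound: "\<And>F. finite F \<Longrightarrow> F \<subseteq> {m..} \<Longrightarrow>
       C * L2_inner (\<lambda>t. \<Sum>n\<in>F. c n * f n t) (\<lambda>t. \<Sum>n\<in>F. c n * f n t) \<le> sum a F"
  obtains g where "g \<in> L2"
    "(\<lambda>N. L2_inner (\<lambda>t. (\<Sum>n\<in>{m..<N}. c n * f n t) - g t) (\<lambda>t. (\<Sum>n\<in>{m..<N}. c n * f n t) - g t)) \<longlonglongrightarrow> 0"
proof (rule L2_complete)
  let ?S = "\<lambda>N t. \<Sum>n\<in>{m..<N}. c n * f n t"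
  show "?S N \<in> L2" for N by (intro L2_sum L2_scale f)
  fix e :: real assume "0 < e"
  then have "0 < C * e" using \<open>0 < C\<close> by simp
  then obtain N where N: "\<And>i j. N \<le> i \<Longrightarrow> norm (sum a {i..<j}) < C * e"
    using a(1) unfolding summable_Cauchy by blast
  have ordered: "L2_inner (\<lambda>t. ?S j t - ?S i t) (\<lambda>t. ?S j t - ?S i t) < e" if "N \<le> i" "i \<le> j" for i j
  proof -
    have diff: "?S j t - ?S i t = (\<Sum>n\<in>{m..<j} - {m..<i}. c n * f n t)" for t
      using that by (intro sum_diff[symmetric]) auto
    have "C * L2_inner (\<lambda>t. ?S j t - ?S i t) (\<lambda>t. ?S j t - ?S i t) \<le> sum a ({m..<j} - {m..<i})"
      unfolding diff by (rule bound) auto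
    also have "\<dots> \<le> sum a {i..<j}"
      by (rule sum_mono2) (use a(2) in auto)
    also have "\<dots> < C * e" using N[OF that(1), of j] by simp
    finally show ?thesis using \<open>0 < C\<close> by simp
  qed
  have swap: "L2_inner (\<lambda>t. ?S j t - ?S i t) (\<lambda>t. ?S j t - ?S i t)
      = L2_inner (\<lambda>t. ?S i t - ?S j t) (\<lambda>t. ?S i t - ?S j t)" for i j
    by (intro L2_inner_cong) (simp add: algebra_simps)
  show "\<exists>N. \<forall>i\<ge>N. \<forall>j\<ge>N. L2_inner (\<lambda>t. ?S i t - ?S j t) (\<lambda>t. ?S i t - ?S j t) < e"
  proof (intro exI[of _ N] allI impI)
    fix i j assume "N \<le> i" "N \<le> j"
    then show "L2_inner (\<lambda>t. ?S i t - ?S j t) (\<lambda>t. ?S i t - ?S j t) < e"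
      using ordered[of i j] ordered[of j i] swap[of j i] by (cases "i \<le> j") auto
  qed
qed (rule that)

text \<open>
  With \<open>g1\<close> and \<open>g2\<close> the \<open>L\<^sup>2\<close> limits of the partial sums of \<open>\<omega> u'\<close> and \<open>u / \<omega>\<close>, the function \<open>u\<close> equals
  \<open>\<omega> g2\<close> almost everywhere and has the weak derivative \<open>g1 / \<omega>\<close>.
\<close>

lemma H_space_subset_Y_space:
  assumes m: "1 \<le> m"
  shows "H_space m 1 \<subseteq> Y_space"
proof
  fix u assume H: "u \<in> H_space m 1"
  then have u: "u \<in> L2" by (simp add: H_space_def)
  define c where "c = (\<lambda>n. L2_inner u (assoc_Q n m))"
  define a where "a = (\<lambda>n. if m \<le> n then real n * (real n + 1) * (c n)\<^sup>2 else 0)"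
  have a: "summable a" "\<And>n. 0 \<le> a n"
    using summable_energy[OF H] unfolding a_def c_def by auto
  have energy: "L2_inner (\<lambda>t. \<Sum>n\<in>F. c n * assoc_dQ n m t) (\<lambda>t. \<Sum>n\<in>F. c n * assoc_dQ n m t)
      + (real m)\<^sup>2 * L2_inner (\<lambda>t. \<Sum>n\<in>F. c n * assoc_Qw n m t) (\<lambda>t. \<Sum>n\<in>F. c n * assoc_Qw n m t) = sum a F"
    if "finite F" "F \<subseteq> {m..}" for F
    unfolding energy_sum[OF m that] using that(2) by (intro sum.cong) (auto simp: a_def)
  define S T P where "S = (\<lambda>N t. \<Sum>n\<in>{m..<N}. c n * assoc_dQ n m t)"
    and "T = (\<lambda>N t. \<Sum>n\<in>{m..<N}. c n * assoc_Qw n m t)"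
    and "P = (\<lambda>N t. \<Sum>n\<in>{m..<N}. c n * assoc_Q n m t)"
  have S: "S N \<in> L2" and T: "T N \<in> L2" and P: "P N \<in> L2" for N
    unfolding S_def T_def P_def by (intro L2_sum L2_scale L2_assoc)+
  obtain g1 where g1: "g1 \<in> L2" and S_lim: "(\<lambda>N. L2_inner (\<lambda>t. S N t - g1 t) (\<lambda>t. S N t - g1 t)) \<longlonglongrightarrow> 0"
  proof (rule L2_Cauchy_partial_sums[of "\<lambda>n. assoc_dQ n m" a 1 m c])
    fix F assume F: "finite F" "F \<subseteq> {m..}"
    have "0 \<le> (real m)\<^sup>2 * L2_inner (\<lambda>t. \<Sum>n\<in>F. c n * assoc_Qw n m t) (\<lambda>t. \<Sum>n\<in>F. c n * assoc_Qw n m t)"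
      by (intro mult_nonneg_nonneg L2_inner_self_nonneg) simp
    then show "1 * L2_inner (\<lambda>t. \<Sum>n\<in>F. c n * assoc_dQ n m t) (\<lambda>t. \<Sum>n\<in>F. c n * assoc_dQ n m t) \<le> sum a F"
      using energy[OF F] by linarith
  qed (use a L2_assoc S_def in auto)
  obtain g2 where g2: "g2 \<in> L2" and T_lim: "(\<lambda>N. L2_inner (\<lambda>t. T N t - g2 t) (\<lambda>t. T N t - g2 t)) \<longlonglongrightarrow> 0"
  proof (rule L2_Cauchy_partial_sums[of "\<lambda>n. assoc_Qw n m" a "(real m)\<^sup>2" m c])
    fix F assume F: "finite F" "F \<subseteq> {m..}"
    have "0 \<le> L2_inner (\<lambda>t. \<Sum>n\<in>F. c n * assoc_dQ n m t) (\<lambda>t. \<Sum>n\<in>F. c n * assoc_dQ n m t)"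
      by (rule L2_inner_self_nonneg)
    then show "(real m)\<^sup>2 * L2_inner (\<lambda>t. \<Sum>n\<in>F. c n * assoc_Qw n m t) (\<lambda>t. \<Sum>n\<in>F. c n * assoc_Qw n m t) \<le> sum a F"
      using energy[OF F] by linarith
  qed (use a L2_assoc T_def m in auto)
  \<comment> \<open>The partial sums of \<open>u\<close> are \<open>\<omega>\<close> times those converging to \<open>g2\<close>, so \<open>\<omega> g2\<close> is the only
    candidate for \<open>u\<close>; completeness of the basis identifies the two.\<close>
  define w where "w = (\<lambda>t. \<omega> t * g2 t)"
  have w: "w \<in> L2" unfolding w_def by (rule L2_omega_mult[OF g2])
  have P_eq: "P N t = \<omega> t * T N t" for N t
    unfolding P_def T_def sum_distrib_left assoc_Q_eq_omega_Qw[OF m] by (simp only: mult.left_commute)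
  have P_lim: "(\<lambda>N. L2_inner (P N) h) \<longlonglongrightarrow> L2_inner w h" if "h \<in> L2" for h
  proof -
    have "(\<lambda>N. L2_inner (T N) (\<lambda>t. \<omega> t * h t)) \<longlonglongrightarrow> L2_inner g2 (\<lambda>t. \<omega> t * h t)"
      by (rule L2_tendsto_inner[OF T g2 L2_omega_mult[OF that] T_lim])
    moreover have "L2_inner (T N) (\<lambda>t. \<omega> t * h t) = L2_inner (P N) h" for N
      by (intro L2_inner_cong) (simp add: P_eq mult_ac)
    moreover have "L2_inner g2 (\<lambda>t. \<omega> t * h t) = L2_inner w h"
      by (intro L2_inner_cong) (simp add: w_def mult_ac)
    ultimately show ?thesis by simp
  qed
  have coeff_w: "L2_inner w (assoc_Q k m) = c k" if "m \<le> k" for k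
  proof (rule LIMSEQ_unique[OF P_lim[OF L2_assoc(1)]])
    have "L2_inner (P N) (assoc_Q k m) = c k" if "k < N" for N
    proof -
      have "L2_inner (P N) (assoc_Q k m) = (\<Sum>n\<in>{m..<N}. c n * L2_inner (assoc_Q n m) (assoc_Q k m))"
        unfolding P_def by (simp add: L2_inner_sum_left L2_scale L2_assoc L2_inner_scale_left)
      also have "\<dots> = (\<Sum>n\<in>{m..<N}. if n = k then c n else 0)"
        unfolding assoc_Q_orthonormal[OF m \<open>m \<le> k\<close>] by (intro sum.cong) auto
      also have "\<dots> = c k" using that \<open>m \<le> k\<close> by simp
      finally show ?thesis .
    qed
    then show "(\<lambda>N. L2_inner (P N) (assoc_Q k m)) \<longlonglongrightarrow> c k"
      by (intro tendsto_eventually) (auto simp: eventually_sequentially intro!: exI[of _ "Suc k"])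
  qed
  have "AE t in \<mu>. u t - w t = 0"
  proof (rule assoc_Q_complete[where m = m])
    show "(\<lambda>t. u t - w t) \<in> L2" by (rule L2_diff[OF u w])
    show "L2_inner (\<lambda>t. u t - w t) (assoc_Q n m) = 0" if "m \<le> n" for n
      using coeff_w[OF that] by (simp add: L2_inner_diff_left u w L2_assoc c_def)
  qed
  then have uw: "AE t in \<mu>. u t = w t" by simp
  have inv: "continuous_on open_ivl (\<lambda>t. inverse (\<omega> t))"
    using omega_pos by (intro continuous_intros) force
  have U: "(\<lambda>t. inverse (\<omega> t) * u t) \<in> L2"
  proof (rule L2_cong_AE[OF g2])
    show "(\<lambda>t. inverse (\<omega> t) * u t) \<in> borel_measurable \<mu>"
      by (intro borel_measurable_times measurable_\<mu>_continuous inv L2D(1)[OF u])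
    show "AE t in \<mu>. g2 t = inverse (\<omega> t) * u t"
      using uw AE_space[of \<mu>] 
      by eventually_elim (use omega_pos in \<open>force simp: w_def\<close>)
  qed
  \<comment> \<open>The terms summed in \<open>S N\<close> are \<open>\<omega> Q'\<close>, hence the division by \<open>\<omega>\<close>.\<close>
  define v where "v = (\<lambda>t. inverse (\<omega> t) * g1 t)"
  have V: "(\<lambda>t. \<omega> t * v t) \<in> L2"
    using L2_cong[of "\<lambda>t. \<omega> t * v t" g1] g1 omega_inverse_mult by (simp add: v_def)
  have "distributional_deriv u v"
    unfolding distributional_deriv_def
  proof (intro conjI allI impI)
    show "locally_integrable u"
      using locally_integrable_mult_L2[OF u, of "\<lambda>t. 1"] by (simp add: continuous_on_const)
    show "locally_integrable v"
      unfolding v_def by (rule locally_integrable_mult_L2[OF g1 inv])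
    fix \<phi> assume test: "test_function \<phi>"
    obtain K where K: "compact K" "K \<subseteq> open_ivl" and zero: "\<And>t. t \<notin> K \<Longrightarrow> \<phi> t = 0" "\<And>t. t \<notin> K \<Longrightarrow> deriv \<phi> t = 0"
      and cont: "\<And>S. continuous_on S \<phi>" "\<And>S. continuous_on S (deriv \<phi>)"
      using test by (rule test_functionD) blast
    have d\<phi>: "deriv \<phi> \<in> L2"
      by (rule L2_compact_support[OF K cont(2) zero(2)])
    have \<phi>\<omega>: "(\<lambda>t. inverse (\<omega> t) * \<phi> t) \<in> L2"
      by (rule L2_compact_support[OF K continuous_on_mult[OF inv cont(1)]]) (simp add: zero)
    have parts: "L2_inner (P N) (deriv \<phi>) = - L2_inner (S N) (\<lambda>t. inverse (\<omega> t) * \<phi> t)" for N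
    proof -
      have "L2_inner (P N) (deriv \<phi>) = - L2_inner (\<lambda>t. inverse (\<omega> t) * S N t) \<phi>"
      proof (rule integration_by_parts_test_function[OF test])
        fix t assume t: "t \<in> open_ivl"
        have "(assoc_Q n m has_real_derivative inverse (\<omega> t) * assoc_dQ n m t) (at t)" for n
          using DERIV_omega_power_poly[OF m t, of "assoc_poly n m"]
          by (simp add: assoc_Q_eq_poly[abs_def] assoc_dQ_def)
        then have "(P N has_real_derivative (\<Sum>n\<in>{m..<N}. c n * (inverse (\<omega> t) * assoc_dQ n m t))) (at t)"
          unfolding P_def by (intro DERIV_sum DERIV_cmult)
        then show "(P N has_real_derivative inverse (\<omega> t) * S N t) (at t)"
          unfolding S_def sum_distrib_left by (simp only: mult.left_commute)
      next
        show "continuous_on open_ivl (\<lambda>t. inverse (\<omega> t) * S N t)"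
          unfolding S_def assoc_dQ_def by (intro continuous_on_mult inv continuous_intros)
      qed
      also have "L2_inner (\<lambda>t. inverse (\<omega> t) * S N t) \<phi> = L2_inner (S N) (\<lambda>t. inverse (\<omega> t) * \<phi> t)"
        by (intro L2_inner_cong) (simp only: mult_ac)
      finally show ?thesis .
    qed
    have "(\<lambda>N. L2_inner (P N) (deriv \<phi>)) \<longlonglongrightarrow> - L2_inner g1 (\<lambda>t. inverse (\<omega> t) * \<phi> t)"
      unfolding parts by (intro tendsto_minus L2_tendsto_inner[OF S g1 \<phi>\<omega> S_lim])
    then have "L2_inner w (deriv \<phi>) = - L2_inner g1 (\<lambda>t. inverse (\<omega> t) * \<phi> t)"
      by (rule LIMSEQ_unique[OF P_lim[OF d\<phi>]])
    moreover have "L2_inner u (deriv \<phi>) = L2_inner w (deriv \<phi>)"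
      unfolding L2_inner_def
    proof (rule integral_cong_AE)
      show "AE t in \<mu>. u t * deriv \<phi> t = w t * deriv \<phi> t" using uw by eventually_elim simp
    qed (intro borel_measurable_times L2D(1) u w d\<phi>)+
    moreover have "L2_inner g1 (\<lambda>t. inverse (\<omega> t) * \<phi> t) = L2_inner v \<phi>"
      by (intro L2_inner_cong) (simp only: v_def mult_ac)
    ultimately show "(LINT t|\<mu>. u t * deriv \<phi> t) = - (LINT t|\<mu>. v t * \<phi> t)"
      by (simp only: L2_inner_def)
  qed
  with U V show "u \<in> Y_space"
    unfolding Y_space_def by blast
qed

section \<open>The case of order zero\<close>

lemma const_1_not_in_Y_space: "(\<lambda>t. 1) \<notin> Y_space"
proof
  assume "(\<lambda>t. 1 :: real) \<in> Y_space"
  then have "(\<lambda>t. inverse (\<omega> t)) \<in> L2" by (simp add: Y_space_def)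
  then have int: "integrable \<mu> (\<lambda>t. 2 * (inverse (\<omega> t) * inverse (\<omega> t)))"
    by (intro integrable_mult_right L2D)
  define I where "I = (LINT t|\<mu>. 2 * (inverse (\<omega> t) * inverse (\<omega> t)))"
  \<comment> \<open>The function \<open>r / (1 - r t)\<close> stays below \<open>2 / (1 - t\<^sup>2)\<close>, while its integral, which is
    \<open>ln (1 + r) - ln (1 - r)\<close>, exceeds the putative bound \<open>I\<close> for this choice of \<open>r\<close>.\<close>
  define r where "r = 1 - exp (- (\<bar>I\<bar> + 1))"
  have "exp (- (\<bar>I\<bar> + 1)) < 1" by simp
  then have r: "0 < r" "r < 1" by (simp_all add: r_def)
  have pos: "0 < 1 - r * t" if "t \<in> {-1..1}" for t
  proof -
    have "r * t \<le> r * 1" using that r by (intro mult_left_mono) auto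
    then show ?thesis using r(2) unfolding mult_1_right by linarith
  qed
  have cont: "continuous_on {-1..1} (\<lambda>t. r / (1 - r * t))"
    using pos by (intro continuous_intros) force
  have "(LINT t|\<mu>. r / (1 - r * t)) = - ln (1 - r * 1) - - ln (1 - r * (-1))"
  proof (rule integral_\<mu>_derivative[OF integrable_\<mu>_continuous[OF cont]])
    fix t :: real assume "t \<in> {-1..1}"
    from pos[OF this] show "((\<lambda>t. - ln (1 - r * t)) has_real_derivative r / (1 - r * t)) (at t)"
      by (auto intro!: derivative_eq_intros)
  qed
  also have "\<dots> = \<bar>I\<bar> + 1 + ln (1 + r)" by (simp add: r_def)
  finally have "\<bar>I\<bar> + 1 \<le> (LINT t|\<mu>. r / (1 - r * t))" using r by simp
  also have "\<dots> \<le> I"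
    unfolding I_def
  proof (rule integral_mono[OF integrable_\<mu>_continuous[OF cont] int])
    fix t assume "t \<in> space \<mu>"
    then have t: "t \<in> open_ivl" by simp
    have w: "0 < 1 - t\<^sup>2" using t square_less_1_iff[of t] by simp
    have "1 - t\<^sup>2 \<le> 2 * (1 - r * t)"
    proof -
      have "r * t \<le> \<bar>t\<bar>"
        using r t by (metis abs_ge_self abs_ge_zero abs_mult abs_of_pos less_imp_le mult_left_le_one_le order_trans)
      moreover have "1 - t\<^sup>2 \<le> 2 * (1 - \<bar>t\<bar>)"
        using zero_le_power2[of "1 - \<bar>t\<bar>"] by (simp add: power2_eq_square algebra_simps)
      moreover have "2 * (1 - \<bar>t\<bar>) \<le> 2 * (1 - r * t)"
        using \<open>r * t \<le> \<bar>t\<bar>\<close> by simp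
      ultimately show ?thesis by (metis order_trans)
    qed
    then have "inverse (2 * (1 - r * t)) \<le> inverse (1 - t\<^sup>2)"
      using w by (rule le_imp_inverse_le)
    moreover have "r / (1 - r * t) \<le> 1 / (1 - r * t)"
      using r pos[of t] t by (intro divide_right_mono) auto
    moreover have "inverse (\<omega> t) * inverse (\<omega> t) = inverse (1 - t\<^sup>2)"
      unfolding omega_square[OF t, symmetric] by (rule inverse_mult_distrib[symmetric])
    moreover have "1 / x = 2 * inverse (2 * x)" for x :: real
      by (simp add: inverse_eq_divide)
    then have "1 / (1 - r * t) = 2 * inverse (2 * (1 - r * t))" .
    ultimately show "r / (1 - r * t) \<le> 2 * (inverse (\<omega> t) * inverse (\<omega> t))" by linarith
  qed
  finally show False by simp
qed

text \<open>
  For \<open>m = 0\<close> the eigenvalue equation reads \<open>((1 - t\<^sup>2) p')' = - n (n + 1) p\<close>, and \<open>(1 - t\<^sup>2) p'\<close> vanishes at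
  the end points.
\<close>

lemma integral_assoc_poly_0:
  assumes "1 \<le> n"
  shows "integral\<^sup>L \<mu> (poly (assoc_poly n 0)) = 0"
proof -
  let ?p = "assoc_poly n 0"
  have "one_minus_sq * pderiv (one_minus_sq * pderiv ?p) = one_minus_sq * smult (- (real n * (real n + 1))) ?p"
    using ang_deriv_ang_deriv_assoc_poly[of 0 n] by (simp add: ang_deriv_def)
  then have "pderiv (one_minus_sq * pderiv ?p) = smult (- (real n * (real n + 1))) ?p"
    by (simp only: mult_cancel_left one_minus_sq_neq_0 simp_thms)
  moreover have "(LINT t|\<mu>. poly (smult k ?p) t) = k * (LINT t|\<mu>. poly ?p t)" for k
    by simp
  ultimately have "- (real n * (real n + 1)) * integral\<^sup>L \<mu> (poly ?p) = integral\<^sup>L \<mu> (poly (pderiv (one_minus_sq * pderiv ?p)))"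
    by metis
  also have "\<dots> = 0" unfolding integral_pderiv by simp
  finally show ?thesis using assms by simp
qed

lemma const_1_in_H_space_0: "(\<lambda>t. 1) \<in> H_space 0 1"
proof -
  have "L2_inner (\<lambda>t. 1) (assoc_Q n 0) = 0" if "n \<noteq> 0" for n
    using integral_assoc_poly_0[of n] that by (simp add: L2_inner_def assoc_Q_eq_poly)
  then have "(\<lambda>n. real (2 * n + 1) powr (2 * 1) * (L2_inner (\<lambda>t. 1) (assoc_Q n 0))\<^sup>2) summable_on {0..}
     \<longleftrightarrow> (\<lambda>n. real (2 * n + 1) powr (2 * 1) * (L2_inner (\<lambda>t. 1) (assoc_Q n 0))\<^sup>2) summable_on {0}"
    by (intro summable_on_cong_neutral) auto
  then show ?thesis
    using L2_1 by (simp add: H_space_def)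
qed

theorem theorem3p8:
  shows "(\<forall>m::nat. m \<ge> 1 \<longrightarrow> H_space m 1 = Y_space) \<and> H_space 0 1 \<noteq> Y_space"
  using Y_space_subset_H_space H_space_subset_Y_space const_1_in_H_space_0 const_1_not_in_Y_space by blast

end
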